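(* Let $U$ be an $n$-qubit state preparation unitary with $U\ket{0}=\sum_{j=1}^N\psi_j\ket{x_j}$, $N=2^n$, where $\psi_j\in\mathbb{R}_{\ge0}$ for all $j$, $\sum_j\psi_j^2=1$, and $\{x_j\}_j$ is some (unknown) ordering of the computational basis states, with $\psi_1>\psi_2\ge\dots\ge\psi_N$. Let $\Delta:=\psi_1-\psi_2$, and suppose the values $\psi_1$ and $\Delta$ are given. Then, with arbitrarily high probability of success and $\tilde O\big(\frac{1}{\psi_1\Delta}\big)$ queries to controlled-$U$ and controlled-$U^\dagger$ circuits, one can determine the basis state $x_1$ with maximum amplitude.
   Context: $\tilde O(\cdot)$ hides polylogarithmic factors (here in $N$, $1/\psi_1$, $1/\Delta$). *)

theory Defs
  imports Complex_Main
begin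

text \<open>A minimal quantum query model.  Square matrices of dimension d are functions
  nat => nat => complex (entries outside the range are irrelevant); states of dimension
  d are functions nat => complex (supported on indices below d).\<close>

definition unitary_fn :: "nat \<Rightarrow> (nat \<Rightarrow> nat \<Rightarrow> complex) \<Rightarrow> bool" where
  "unitary_fn d A \<longleftrightarrow>
     (\<forall>i<d. \<forall>j<d. (\<Sum>k<d. cnj (A k i) * A k j) = (if i = j then 1 else 0))"

definition adjoint_fn :: "(nat \<Rightarrow> nat \<Rightarrow> complex) \<Rightarrow> (nat \<Rightarrow> nat \<Rightarrow> complex)" where
  "adjoint_fn A = (\<lambda>i j. cnj (A j i))"

definition apply_fn :: "nat \<Rightarrow> (nat \<Rightarrow> nat \<Rightarrow> complex) \<Rightarrow> (nat \<Rightarrow> complex) \<Rightarrow> (nat \<Rightarrow> complex)" where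
  "apply_fn d A v = (\<lambda>i. if i < d then (\<Sum>j<d. A i j * v j) else 0)"

text \<open>Workspace of dimension N * M: basis index k corresponds to (x, r) with
  x = k mod N (the n-qubit register on which U acts, N = 2^n) and r = k div N < M
  (the remaining qubits); the lowest bit of r is the control qubit.
  Controlled-V applies V to the x register iff the control bit is 1.\<close>

definition controlled_apply ::
  "nat \<Rightarrow> nat \<Rightarrow> (nat \<Rightarrow> nat \<Rightarrow> complex) \<Rightarrow> (nat \<Rightarrow> complex) \<Rightarrow> (nat \<Rightarrow> complex)" where
  "controlled_apply N M V v = (\<lambda>k.
     if k < N * M \<and> odd (k div N)
     then (\<Sum>y<N. V (k mod N) y * v (y + N * (k div N)))
     else v k)"

datatype qstep = Gate "nat \<Rightarrow> nat \<Rightarrow> complex" | QueryU | QueryUdag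

text \<open>A query algorithm: number m of extra qubits (workspace dimension 2^n * 2^m),
  a list of steps (arbitrary fixed unitaries and queries to controlled-U / controlled-U^dagger),
  and a classical post-processing map from the measured basis index to an output.\<close>

record qalg =
  extra_qubits :: nat
  steps :: "qstep list"
  out_map :: "nat \<Rightarrow> nat"

definition alg_dim :: "nat \<Rightarrow> qalg \<Rightarrow> nat" where
  "alg_dim N A = N * 2 ^ extra_qubits A"

definition valid_alg :: "nat \<Rightarrow> qalg \<Rightarrow> bool" where
  "valid_alg N A \<longleftrightarrow> extra_qubits A \<ge> 1 \<and>
     (\<forall>G. Gate G \<in> set (steps A) \<longrightarrow> unitary_fn (alg_dim N A) G)"

fun step_apply :: "nat \<Rightarrow> nat \<Rightarrow> (nat \<Rightarrow> nat \<Rightarrow> complex) \<Rightarrow> qstep \<Rightarrow> (nat \<Rightarrow> complex) \<Rightarrow> (nat \<Rightarrow> complex)" where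
  "step_apply N M U (Gate G) v = apply_fn (N * M) G v"
| "step_apply N M U QueryU v = controlled_apply N M U v"
| "step_apply N M U QueryUdag v = controlled_apply N M (adjoint_fn U) v"

fun is_query :: "qstep \<Rightarrow> bool" where
  "is_query (Gate G) = False"
| "is_query QueryU = True"
| "is_query QueryUdag = True"

definition num_queries :: "qalg \<Rightarrow> nat" where
  "num_queries A = length (filter is_query (steps A))"

definition final_state :: "nat \<Rightarrow> (nat \<Rightarrow> nat \<Rightarrow> complex) \<Rightarrow> qalg \<Rightarrow> (nat \<Rightarrow> complex)" where
  "final_state N U A =
     fold (step_apply N (2 ^ extra_qubits A) U) (steps A) (\<lambda>k. if k = 0 then 1 else 0)"

definition success_prob :: "nat \<Rightarrow> (nat \<Rightarrow> nat \<Rightarrow> complex) \<Rightarrow> qalg \<Rightarrow> nat \<Rightarrow> real" where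
  "success_prob N U A x =
     (\<Sum>k<alg_dim N A. if out_map A k = x then (cmod (final_state N U A k))\<^sup>2 else 0)"

end

theory Submission
  imports Defs "HOL-Analysis.L2_Norm" "HOL-Computational_Algebra.Polynomial"
    "Jordan_Normal_Form.Determinant"
begin

text \<open>
  Two registers hold copies of the state \<open>\<Psi> = U|0\<rangle> \<otimes> (s|1\<rangle> + sqrt(1 - s\<^sup>2)|0\<rangle>)\<close>. For a basis state
  \<open>q\<close> of the second copy, the Grover operator \<open>Q\<^sub>q\<close> built from the reflections about \<open>\<Psi>\<close> and \<open>q\<close> acts
  on the first copy as a rotation with phases \<open>-exp(\<plusminus>2i\<theta>\<^sub>q)\<close>, where \<open>sin \<theta>\<^sub>q = s\<psi>\<^sub>q\<close>. A counter
  prepared in \<open>\<Sum>\<^sub>k a\<^sub>k|k\<rangle>\<close> controls \<open>Q\<^sub>q\<^sup>k\<close>, so it picks up the wave \<open>(a\<^sub>k \<mu>\<^sup>k)\<^sub>k\<close> for each eigenvalue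
  \<open>\<mu>\<close>. If \<open>a\<^sub>k\<^sup>2\<close> are the coefficients of \<open>((1 + z + \<dots> + z\<^sup>L\<^sup>-\<^sup>1)/L)\<^sup>r\<close> with \<open>L\<close> of order \<open>1/\<Delta>\<close>, waves
  whose phases are separated by the gap overlap by at most \<open>2\<^sup>-\<^sup>r\<close>. Reflecting the counter about the two
  known waves of the maximal amplitude and undoing the controlled powers therefore flips the sign of
  \<open>x\<^sub>1\<close> alone, up to \<open>O(2\<^sup>-\<^sup>r)\<close>. With this approximate oracle, \<open>T\<close> Grover iterations on the second copy
  reach \<open>x\<^sub>1\<close> exactly, because \<open>s\<close> is chosen such that \<open>(2T + 1) \<theta>\<^sub>1 = \<pi>/2\<close> with \<open>T\<close> of order \<open>1/\<psi>\<^sub>1\<close>.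
\<close>

section \<open>Isometries of finite-dimensional function spaces\<close>

definition ip :: "'i set \<Rightarrow> ('i \<Rightarrow> complex) \<Rightarrow> ('i \<Rightarrow> complex) \<Rightarrow> complex" where
  "ip X f g = (\<Sum>x\<in>X. cnj (f x) * g x)"

definition l2 :: "'i set \<Rightarrow> ('i \<Rightarrow> complex) \<Rightarrow> real" where
  "l2 X f = L2_set (\<lambda>x. cmod (f x)) X"

text \<open>Linearity is asked of functions on the whole type, as equations between functions that
  can be rewritten with; only the inner product is restricted to \<open>X\<close>.\<close>

definition isometry_on :: "'i set \<Rightarrow> (('i \<Rightarrow> complex) \<Rightarrow> 'i \<Rightarrow> complex) \<Rightarrow> bool" where
  "isometry_on X T \<longleftrightarrow>
     (\<forall>f g. T (\<lambda>x. f x + g x) = (\<lambda>x. T f x + T g x)) \<and>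
     (\<forall>c f. T (\<lambda>x. c * f x) = (\<lambda>x. c * T f x)) \<and>
     (\<forall>f g. ip X (T f) (T g) = ip X f g)"

lemma isometry_onI:
  assumes "\<And>f g x. T (\<lambda>x. f x + g x) x = T f x + T g x"
    and "\<And>c f x. T (\<lambda>x. c * f x) x = c * T f x"
    and "\<And>f g. ip X (T f) (T g) = ip X f g"
  shows "isometry_on X T"
  using assms by (auto simp: isometry_on_def)

lemma isometry_on_add: "isometry_on X T \<Longrightarrow> T (\<lambda>x. f x + g x) = (\<lambda>x. T f x + T g x)"
  and isometry_on_scale: "isometry_on X T \<Longrightarrow> T (\<lambda>x. c * f x) = (\<lambda>x. c * T f x)"
  and isometry_on_ip: "isometry_on X T \<Longrightarrow> ip X (T f) (T g) = ip X f g"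
  by (auto simp: isometry_on_def)

lemma isometry_on_zero: "isometry_on X T \<Longrightarrow> T (\<lambda>x. 0) = (\<lambda>x. 0)"
  using isometry_on_scale[of X T 0 "\<lambda>x. 0"] by simp

lemma isometry_on_diff:
  assumes "isometry_on X T" shows "T (\<lambda>x. f x - g x) = (\<lambda>x. T f x - T g x)"
  using isometry_on_add[OF assms, of f "\<lambda>x. - 1 * g x"] isometry_on_scale[OF assms, of "-1" g]
  by simp

lemma isometry_on_sum:
  assumes "isometry_on X T" "finite A"
  shows "T (\<lambda>x. \<Sum>a\<in>A. c a * h a x) = (\<lambda>x. \<Sum>a\<in>A. c a * T (h a) x)"
  using assms(2)
proof (induction A rule: finite_induct)
  case empty then show ?case by (simp add: isometry_on_zero[OF assms(1)])
next
  case (insert a A)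
  then show ?case
    by (simp add: isometry_on_add[OF assms(1), of "\<lambda>x. c a * h a x"] isometry_on_scale[OF assms(1)])
qed

lemma ip_self: "ip X f f = of_real ((l2 X f)\<^sup>2)"
proof -
  have "cnj z * z = of_real ((cmod z)\<^sup>2)" for z
    by (metis complex_norm_square mult.commute)
  then show ?thesis
    by (simp add: ip_def l2_def L2_set_def sum_nonneg)
qed

lemma l2_sq: "(l2 X f)\<^sup>2 = (\<Sum>x\<in>X. (cmod (f x))\<^sup>2)"
  by (simp add: l2_def L2_set_def sum_nonneg)

lemma l2_nonneg [simp]: "0 \<le> l2 X f"
  by (simp add: l2_def)

lemma isometry_on_l2: "isometry_on X T \<Longrightarrow> l2 X (T f) = l2 X f"
  using ip_self[of X "T f"] ip_self[of X f] isometry_on_ip[of X T f f]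
  by (simp add: power2_eq_iff_nonneg del: of_real_power)

lemma l2_triangle: "l2 X (\<lambda>x. f x + g x) \<le> l2 X f + l2 X g"
  unfolding l2_def
  by (rule order_trans[OF L2_set_mono L2_set_triangle_ineq]) (auto intro: norm_triangle_ineq)

lemma l2_subset: "finite X \<Longrightarrow> Y \<subseteq> X \<Longrightarrow> l2 Y f \<le> l2 X f"
  unfolding l2_def L2_set_def by (simp add: sum_mono2)

text \<open>By linearity and norm preservation a function vanishing on \<open>X\<close> goes to one
  vanishing on \<open>X\<close>, so values outside the register cannot leak in.\<close>

lemma isometry_on_cong:
  assumes "isometry_on X T" "finite X" "\<And>x. x \<in> X \<Longrightarrow> f x = g x" "x \<in> X"
  shows "T f x = T g x"
proof -
  have "l2 X (\<lambda>x. T f x - T g x) = l2 X (\<lambda>x. f x - g x)"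
    using isometry_on_l2[OF assms(1), of "\<lambda>x. f x - g x"]
    by (simp add: isometry_on_diff[OF assms(1)])
  also have "\<dots> = 0"
    unfolding l2_def by (rule L2_set_0') (simp add: assms)
  finally show ?thesis
    using assms by (simp add: l2_def L2_set_eq_0_iff)
qed

lemma isometry_on_id: "isometry_on X (\<lambda>f. f)"
  by (simp add: isometry_on_def)

lemma isometry_on_comp:
  "isometry_on X T \<Longrightarrow> isometry_on X T' \<Longrightarrow> isometry_on X (\<lambda>f. T (T' f))"
  by (simp add: isometry_on_def)

lemma isometry_on_funpow:
  "isometry_on X T \<Longrightarrow> isometry_on X (T ^^ k)"
  by (induction k) (auto simp: isometry_on_def)

section \<open>Block-diagonal operators: one tensor factor is acted on, controlled by the
  other\<close>

definition slice1 :: "('j \<Rightarrow> ('i \<Rightarrow> complex) \<Rightarrow> 'i \<Rightarrow> complex) \<Rightarrow> ('i \<times> 'j \<Rightarrow> complex) \<Rightarrow> 'i \<times> 'j \<Rightarrow> complex"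
  where "slice1 T f = (\<lambda>(i, j). T j (\<lambda>i. f (i, j)) i)"

definition slice2 :: "('i \<Rightarrow> ('j \<Rightarrow> complex) \<Rightarrow> 'j \<Rightarrow> complex) \<Rightarrow> ('i \<times> 'j \<Rightarrow> complex) \<Rightarrow> 'i \<times> 'j \<Rightarrow> complex"
  where "slice2 T f = (\<lambda>(i, j). T i (\<lambda>j. f (i, j)) j)"

lemma slice1_apply [simp]: "slice1 T f (i, j) = T j (\<lambda>i. f (i, j)) i"
  by (simp add: slice1_def)

lemma slice2_apply [simp]: "slice2 T f (i, j) = T i (\<lambda>j. f (i, j)) j"
  by (simp add: slice2_def)

lemma ip_Times1: "ip (A \<times> B) f g = (\<Sum>j\<in>B. ip A (\<lambda>i. f (i, j)) (\<lambda>i. g (i, j)))"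
  unfolding ip_def by (subst sum.swap) (simp add: sum.cartesian_product case_prod_unfold)

lemma ip_Times2: "ip (A \<times> B) f g = (\<Sum>i\<in>A. ip B (\<lambda>j. f (i, j)) (\<lambda>j. g (i, j)))"
  unfolding ip_def by (simp add: sum.cartesian_product case_prod_unfold)

lemma isometry_on_slice1:
  assumes "\<And>j. isometry_on A (T j)"
  shows "isometry_on (A \<times> B) (slice1 T)"
  unfolding isometry_on_def
  by (auto simp: ip_Times1 isometry_on_ip[OF assms] isometry_on_add[OF assms]
      isometry_on_scale[OF assms] fun_eq_iff)

lemma isometry_on_slice2:
  assumes "\<And>i. isometry_on B (T i)"
  shows "isometry_on (A \<times> B) (slice2 T)"
  unfolding isometry_on_def
  by (auto simp: ip_Times2 isometry_on_ip[OF assms] isometry_on_add[OF assms]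
      isometry_on_scale[OF assms] fun_eq_iff)

section \<open>Householder reflections\<close>

definition reflect :: "'i set \<Rightarrow> ('i \<Rightarrow> complex) \<Rightarrow> ('i \<Rightarrow> complex) \<Rightarrow> 'i \<Rightarrow> complex" where
  "reflect X w f = (\<lambda>x. f x - 2 * ip X w f * w x)"

lemma ip_add_right: "ip X f (\<lambda>x. g x + h x) = ip X f g + ip X f h"
  by (simp add: ip_def algebra_simps sum.distrib)

lemma ip_diff_right: "ip X f (\<lambda>x. g x - h x) = ip X f g - ip X f h"
  by (simp add: ip_def algebra_simps sum_subtractf)

lemma ip_diff_left: "ip X (\<lambda>x. g x - h x) f = ip X g f - ip X h f"
  by (simp add: ip_def algebra_simps sum_subtractf)

lemma ip_scale_right: "ip X f (\<lambda>x. c * g x) = c * ip X f g"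
  by (simp add: ip_def sum_distrib_left mult.left_commute)

lemma ip_scale_left: "ip X (\<lambda>x. c * g x) f = cnj c * ip X g f"
  by (simp add: ip_def sum_distrib_left mult.assoc)

lemma ip_commute: "ip X f g = cnj (ip X g f)"
  by (simp add: ip_def mult.commute)

lemmas ip_linear = ip_add_right ip_diff_right ip_diff_left ip_scale_right ip_scale_left

text \<open>The correction terms cancel when \<open>w\<close> is a unit vector and vanish when
  \<open>w = 0\<close>. The degenerate case makes the reflection the identity, which later treats
  unmarked states uniformly.\<close>

lemma isometry_on_reflect:
  assumes "ip X w w = 1 \<or> w = (\<lambda>_. 0)"
  shows "isometry_on X (reflect X w)"
proof (rule isometry_onI)
  fix f g
  have "ip X (reflect X w f) (reflect X w g) = ip X f g
     - 4 * (ip X f w * ip X w g) + 4 * (ip X f w * ip X w g) * ip X w w"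
    unfolding reflect_def ip_linear
    by (simp add: ip_commute[of X w f] algebra_simps)
  then show "ip X (reflect X w f) (reflect X w g) = ip X f g"
    using assms by (auto simp: ip_def)
qed (simp_all add: reflect_def ip_linear algebra_simps)

lemma reflect_reflect:
  assumes "ip X w w = 1 \<or> w = (\<lambda>_. 0)"
  shows "reflect X w (reflect X w f) = f"
proof -
  have "reflect X w (reflect X w f) = (\<lambda>x. f x - 4 * ip X w f * w x + 4 * ip X w f * (ip X w w * w x))"
    unfolding reflect_def ip_linear by (simp add: algebra_simps)
  then show ?thesis using assms by auto
qed

section \<open>Unitary matrices as isometries\<close>

definition mat_op :: "nat \<Rightarrow> (nat \<Rightarrow> nat \<Rightarrow> complex) \<Rightarrow> (nat \<Rightarrow> complex) \<Rightarrow> nat \<Rightarrow> complex" where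
  "mat_op d A f = (\<lambda>i. \<Sum>j<d. A i j * f j)"

text \<open>The predicate \<open>unitary_fn\<close> only says that the columns are orthonormal; for the rows one needs that
  a one-sided inverse of a square matrix is two-sided.\<close>

lemma unitary_adjoint:
  assumes "unitary_fn d A"
  shows "unitary_fn d (adjoint_fn A)"
proof -
  define B where "B = mat d d (\<lambda>(i, j). A i j)"
  define C where "C = mat d d (\<lambda>(i, j). cnj (A j i))"
  have "C * B = 1\<^sub>m d"
    using assms by (auto simp: B_def C_def unitary_fn_def scalar_prod_def atLeast0LessThan)
  then have BC: "B * C = 1\<^sub>m d"
    by (rule mat_mult_left_right_inverse[rotated 2]) (auto simp: B_def C_def)
  show ?thesis
    unfolding unitary_fn_def adjoint_fn_def
  proof (intro allI impI)
    fix i j assume ij: "i < d" "j < d"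
    have "(B * C) $$ (i, j) = (\<Sum>k<d. A i k * cnj (A j k))"
      using ij by (auto simp: B_def C_def scalar_prod_def atLeast0LessThan)
    then show "(\<Sum>k<d. cnj (cnj (A i k)) * cnj (A j k)) = (if i = j then 1 else 0)"
      using ij by (simp add: BC)
  qed
qed

lemma adjoint_adjoint [simp]: "adjoint_fn (adjoint_fn A) = A"
  by (simp add: adjoint_fn_def)

lemma mat_op_adjoint:
  assumes "unitary_fn d A" "i < d"
  shows "mat_op d A (mat_op d (adjoint_fn A) f) i = f i"
proof -
  have "mat_op d A (mat_op d (adjoint_fn A) f) i = (\<Sum>k<d. \<Sum>j<d. A i j * cnj (A k j) * f k)"
    unfolding mat_op_def adjoint_fn_def
    by (subst sum.swap) (simp add: sum_distrib_left mult.assoc)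
  also have "\<dots> = (\<Sum>k<d. (if i = k then 1 else 0) * f k)"
    using unitary_adjoint[OF assms(1)] assms(2)
    by (intro sum.cong) (auto simp: unitary_fn_def adjoint_fn_def sum_distrib_right[symmetric])
  also have "\<dots> = (\<Sum>k<d. if i = k then f k else 0)"
    by (intro sum.cong) auto
  also have "\<dots> = f i" using assms(2) by simp
  finally show ?thesis .
qed

lemma ip_mat_op_adjoint:
  "ip {..<d} f (mat_op d (adjoint_fn A) g) = ip {..<d} (mat_op d A f) g"
  unfolding ip_def mat_op_def adjoint_fn_def sum_distrib_left cnj_sum sum_distrib_right
  by (subst sum.swap) (simp add: mult_ac)

lemma ip_cong: "(\<And>x. x \<in> X \<Longrightarrow> f x = f' x) \<Longrightarrow> (\<And>x. x \<in> X \<Longrightarrow> g x = g' x) \<Longrightarrow> ip X f g = ip X f' g'"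
  unfolding ip_def by (rule sum.cong) auto

lemma isometry_on_mat_op:
  assumes "unitary_fn d A"
  shows "isometry_on {..<d} (mat_op d A)"
proof (rule isometry_onI)
  fix f g
  have "ip {..<d} f g = ip {..<d} f (mat_op d (adjoint_fn A) (mat_op d A g))"
    using mat_op_adjoint[OF unitary_adjoint[OF assms]] by (intro ip_cong) auto
  then show "ip {..<d} (mat_op d A f) (mat_op d A g) = ip {..<d} f g"
    by (simp add: ip_mat_op_adjoint)
qed (simp_all add: mat_op_def algebra_simps sum.distrib sum_distrib_left)

section \<open>Operators realised by query circuits\<close>

type_synonym index = "(nat \<times> bool) \<times> (nat \<times> bool) \<times> nat"

locale workspace =
  fixes n l :: nat
begin

definition N :: nat where "N = 2 ^ n"
definition K :: nat where "K = 2 ^ l"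
definition M :: nat where "M = 2 ^ (n + l + 3)"
definition P :: "(nat \<times> bool) set" where "P = {..<N} \<times> UNIV"
definition X :: "index set" where "X = P \<times> P \<times> {..<K}"

text \<open>The leading \<open>1\<close> keeps the control qubit set, so every query acts unconditionally on the encoded
  states; conditioning is done by the gates between \<open>U\<close> and its adjoint instead.\<close>

definition row :: "bool \<Rightarrow> bool \<Rightarrow> nat \<Rightarrow> nat \<Rightarrow> nat" where
  "row b c x k = 1 + 2 * (of_bool b + 2 * (of_bool c + 2 * (x + N * k)))"

text \<open>The basis state of the first copy is the lowest digit, because that is the register
  queries act on; its flag and everything else go into the row.\<close>

definition enc :: "index \<Rightarrow> nat" where
  "enc = (\<lambda>((y, b), (x, c), k). y + N * row b c x k)"

definition dec :: "nat \<Rightarrow> index" where "dec = inv_into X enc"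

definition emb :: "(index \<Rightarrow> complex) \<Rightarrow> nat \<Rightarrow> complex" where
  "emb f = (\<lambda>i. if i \<in> enc ` X then f (dec i) else 0)"

lemma N_pos [simp]: "0 < N" and K_pos [simp]: "0 < K" and M_eq: "M = 8 * N * K"
  by (simp_all add: N_def K_def M_def power_add)

lemma finite_P [simp]: "finite P" and finite_X [simp]: "finite X"
  by (simp_all add: P_def X_def)

lemma mem_P [simp]: "(y, b) \<in> P \<longleftrightarrow> y < N"
  by (simp add: P_def)

lemma sum_X: "(\<Sum>x\<in>X. F x) = (\<Sum>q\<in>P. \<Sum>k<K. \<Sum>p\<in>P. F (p, q, k))"
proof -
  have "(\<Sum>x\<in>X. F x) = (\<Sum>p\<in>P. \<Sum>j\<in>P \<times> {..<K}. F (p, j))"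
    unfolding X_def by (simp add: sum.cartesian_product case_prod_unfold)
  also have "\<dots> = (\<Sum>j\<in>P \<times> {..<K}. \<Sum>p\<in>P. F (p, j))"
    by (rule sum.swap)
  also have "\<dots> = (\<Sum>q\<in>P. \<Sum>k<K. \<Sum>p\<in>P. F (p, q, k))"
    using sum.cartesian_product[where g = "\<lambda>q k. \<Sum>p\<in>P. F (p, q, k)" and A = P and B = "{..<K}"]
    by (simp add: case_prod_unfold)
  finally show ?thesis .
qed

lemma enc_div: "y < N \<Longrightarrow> enc ((y, b), (x, c), k) div N = row b c x k"
  and enc_mod: "y < N \<Longrightarrow> enc ((y, b), (x, c), k) mod N = y"
  by (simp_all add: enc_def)

lemma inj_enc: "inj_on enc X"
proof (rule inj_onI)
  fix i j assume ij: "i \<in> X" "j \<in> X" "enc i = enc j"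
  obtain y b x c k where i: "i = ((y, b), (x, c), k)" by (metis surj_pair)
  obtain y' b' x' c' k' where j: "j = ((y', b'), (x', c'), k')" by (metis surj_pair)
  have bd: "y < N" "y' < N" "x < N" "x' < N"
    using ij(1,2) by (auto simp: i j X_def P_def)
  have "enc i mod N = y" "enc j mod N = y'"
    using bd by (simp_all add: i j enc_mod)
  then have y: "y = y'" using ij(3) by simp
  have "row b c x k = row b' c' x' k'"
    using ij(3) bd by (metis i j enc_div)
  then have "of_bool b + 2 * (of_bool c + 2 * (x + N * k)) =
     of_bool b' + 2 * (of_bool c' + 2 * (x' + N * k'))"
    by (simp add: row_def)
  then have b: "b = b'" and "of_bool c + 2 * (x + N * k) = of_bool c' + 2 * (x' + N * k')"
    by (cases b; cases b'; simp; presburger)+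
  then have c: "c = c'" and xk: "x + N * k = x' + N * k'"
    by (cases c; cases c'; simp; presburger)+
  have "(x + N * k) mod N = x" "(x' + N * k') mod N = x'"
    using bd by simp_all
  then have "x = x'" using xk by simp
  with xk N_pos y b c show "i = j" by (auto simp: i j)
qed

lemma dec_enc [simp]: "x \<in> X \<Longrightarrow> dec (enc x) = x"
  by (simp add: dec_def inv_into_f_f inj_enc)

lemma emb_enc [simp]: "x \<in> X \<Longrightarrow> emb f (enc x) = f x"
  by (simp add: emb_def)

lemma enc_image: "enc ` X = {i. i < N * M \<and> odd (i div N)}"
proof safe
  fix y b x c k assume a: "((y, b), (x, c), k) \<in> X"
  then have bd: "y < N" "x < N" "k < K" by (auto simp: X_def P_def)
  show "enc ((y, b), (x, c), k) < N * M"
  proof -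
    have "x + N * k < N * K"
    proof -
      have "x + N * k < N + N * k" using bd by simp
      also have "\<dots> = N * (k + 1)" by simp
      also have "\<dots> \<le> N * K" using bd by (intro mult_le_mono) auto
      finally show ?thesis .
    qed
    then have "row b c x k < M"
      by (cases b; cases c) (auto simp: M_eq row_def)
    then have "enc ((y, b), (x, c), k) div N < M"
      by (simp add: enc_div[OF bd(1)])
    then show ?thesis
      by (simp add: div_less_iff_less_mult mult.commute)
  qed
  show "even (enc ((y, b), (x, c), k) div N) \<Longrightarrow> False"
    by (simp add: enc_div[OF bd(1)] row_def)
next
  fix i assume i: "i < N * M" "odd (i div N)"
  \<comment> \<open>Inverting the encoding: after dropping the control bit, the two flags are the
    next two bits, and the rest splits modulo \<open>N\<close>.\<close>
  define r where "r = i div N div 2"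
  define x where "x = r div 4 mod N"
  define k where "k = r div 4 div N"
  have "i div N < M" using i(1) by (simp add: less_mult_imp_div_less mult.commute)
  then have "r < 4 * N * K" by (simp add: r_def M_eq less_mult_imp_div_less mult.commute)
  then have k: "k < K"
    by (simp add: k_def less_mult_imp_div_less mult.commute mult.left_commute)
  have r: "i div N = 1 + 2 * r" using i(2) by (simp add: r_def odd_two_times_div_two_succ)
  have xk: "x + N * k = r div 4" by (simp add: x_def k_def)
  have "r = of_bool (odd r) + 2 * (of_bool (odd (r div 2)) + 2 * (r div 4))"
    by (simp add: odd_iff_mod_2_eq_one) presburger
  then have "enc ((i mod N, odd r), (x, odd (r div 2)), k) = i"
    unfolding enc_def row_def prod.case xk by (metis r mod_mult_div_eq)
  moreover have "((i mod N, odd r), (x, odd (r div 2)), k) \<in> X"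
    using k by (simp add: X_def P_def x_def)
  ultimately show "i \<in> enc ` X" by (metis image_eqI)
qed

lemma enc_less: "x \<in> X \<Longrightarrow> enc x < N * M"
  using enc_image by auto

lemma sum_enc:
  "(\<Sum>i<N * M. if i \<in> enc ` X then h i else 0) = (\<Sum>x\<in>X. h (enc x))"
proof -
  have "(\<Sum>i<N * M. if i \<in> enc ` X then h i else 0) = (\<Sum>i\<in>enc ` X. h i)"
    using enc_less by (intro sum.mono_neutral_cong_right) auto
  also have "\<dots> = (\<Sum>x\<in>X. h (enc x))"
    by (simp add: sum.reindex inj_enc)
  finally show ?thesis .
qed

lemma emb_cong: "(\<And>x. x \<in> X \<Longrightarrow> f x = g x) \<Longrightarrow> emb f = emb g"
  by (auto simp: emb_def fun_eq_iff)

definition query_op :: "(nat \<Rightarrow> nat \<Rightarrow> complex) \<Rightarrow> (index \<Rightarrow> complex) \<Rightarrow> index \<Rightarrow> complex" where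
  "query_op V = slice1 (\<lambda>_. slice1 (\<lambda>_. mat_op N V))"

text \<open>All positions that a query mixes share one row, and an encoded row is odd, so the whole
  fibre is encoded and the control is on. Elsewhere the state is 0 and the query leaves it
  alone.\<close>

lemma controlled_apply_emb: "controlled_apply N M V (emb f) = emb (query_op V f)"
proof
  fix i
  show "controlled_apply N M V (emb f) i = emb (query_op V f) i"
  proof (cases "i \<in> enc ` X")
    case True
    then obtain y b x c k where i: "i = enc ((y, b), (x, c), k)" and X: "((y, b), (x, c), k) \<in> X"
      by auto
    then have bd: "y < N" by (auto simp: X_def P_def)
    have im: "i mod N = y" using bd by (simp add: i enc_mod)
    have "emb f (y' + N * (i div N)) = f ((y', b), (x, c), k)" if "y' < N" for y'
    proof -
      have "y' + N * (i div N) = enc ((y', b), (x, c), k)"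
        by (simp add: i enc_div[OF bd]) (simp add: enc_def)
      moreover have "((y', b), (x, c), k) \<in> X" using X that by (auto simp: X_def P_def)
      ultimately show ?thesis by (metis emb_enc)
    qed
    then have "controlled_apply N M V (emb f) i = (\<Sum>y'<N. V y y' * f ((y', b), (x, c), k))"
      using True by (simp add: controlled_apply_def enc_image im)
    also have "\<dots> = emb (query_op V f) i"
      unfolding i emb_enc[OF X] by (simp add: query_op_def mat_op_def)
    finally show ?thesis .
  next
    case False
    then show ?thesis by (auto simp: emb_def controlled_apply_def enc_image)
  qed
qed

text \<open>The columns of \<open>G\<close> at encoded positions are the images of basis vectors
  under \<open>T\<close>, the remaining columns are those of the identity. The two groups have
  disjoint supports, so \<open>G\<close> is unitary.\<close>

lemma gate_of_isometry:
  assumes "isometry_on X T"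
  shows "\<exists>G. unitary_fn (N * M) G \<and> (\<forall>f. apply_fn (N * M) G (emb f) = emb (T f))"
proof -
  define e where "e x = (\<lambda>y. if y = x then 1 else 0 :: complex)" for x :: index
  define G where "G i j = (if j \<in> enc ` X then emb (T (e (dec j))) i
      else if i = j then 1 else 0)" for i j
  have G_enc: "G i (enc x) = emb (T (e x)) i" if "x \<in> X" for i x
    using that by (simp add: G_def)
  have ip_e: "ip X (e x) (e y) = (if x = y then 1 else 0)" if "x \<in> X" "y \<in> X" for x y
  proof -
    have "ip X (e x) (e y) = (\<Sum>z\<in>X. if z = x then (if x = y then 1 else 0) else 0)"
      unfolding ip_def by (rule sum.cong) (auto simp: e_def)
    then show ?thesis using that by simp
  qed
  have "unitary_fn (N * M) G"
    unfolding unitary_fn_def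
  proof (intro allI impI)
    fix i j assume ij: "i < N * M" "j < N * M"
    consider (a) x y where "x \<in> X" "y \<in> X" "i = enc x" "j = enc y"
      | (b) "i \<in> enc ` X" "j \<notin> enc ` X" | (c) "i \<notin> enc ` X" "j \<in> enc ` X"
      | (d) "i \<notin> enc ` X" "j \<notin> enc ` X" by blast
    then show "(\<Sum>k<N * M. cnj (G k i) * G k j) = (if i = j then 1 else 0)"
    proof cases
      case a
      have "(\<Sum>k<N * M. cnj (G k i) * G k j) =
          (\<Sum>k<N * M. if k \<in> enc ` X then cnj (T (e x) (dec k)) * T (e y) (dec k) else 0)"
        using a by (intro sum.cong) (auto simp: G_enc emb_def)
      also have "\<dots> = ip X (T (e x)) (T (e y))"
        unfolding sum_enc ip_def by (intro sum.cong) auto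
      also have "\<dots> = (if x = y then 1 else 0)"
        using a ip_e isometry_on_ip[OF assms] by simp
      finally show ?thesis using a inj_enc by (auto simp: inj_on_eq_iff)
    next
      case b
      then have "(\<Sum>k<N * M. cnj (G k i) * G k j) = 0"
        by (intro sum.neutral) (auto simp: G_def emb_def)
      then show ?thesis using b by auto
    next
      case c
      then have "(\<Sum>k<N * M. cnj (G k i) * G k j) = 0"
        by (intro sum.neutral) (auto simp: G_def emb_def)
      then show ?thesis using c by auto
    next
      case d
      then have "(\<Sum>k<N * M. cnj (G k i) * G k j) = (\<Sum>k<N * M. if k = i then (if i = j then 1 else 0) else 0)"
        by (intro sum.cong) (auto simp: G_def)
      then show ?thesis using ij by simp
    qed
  qed
  moreover have "apply_fn (N * M) G (emb f) = emb (T f)" for f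
  proof
    fix i
    have f: "f x = (\<Sum>y\<in>X. f y * e y x)" if "x \<in> X" for x
    proof -
      have "(\<Sum>y\<in>X. f y * e y x) = (\<Sum>y\<in>X. if y = x then f y else 0)"
        by (intro sum.cong) (auto simp: e_def)
      then show ?thesis using that by simp
    qed
    have Tf: "T f x = (\<Sum>y\<in>X. f y * T (e y) x)" if "x \<in> X" for x
    proof -
      have "T f x = T (\<lambda>x. \<Sum>y\<in>X. f y * e y x) x"
        using that f by (intro isometry_on_cong[OF assms finite_X]) auto
      then show ?thesis by (simp add: isometry_on_sum[OF assms])
    qed
    show "apply_fn (N * M) G (emb f) i = emb (T f) i"
    proof (cases "i < N * M")
      case True
      have "apply_fn (N * M) G (emb f) i = (\<Sum>j<N * M. G i j * emb f j)"
        using True by (simp add: apply_fn_def)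
      also have "\<dots> = (\<Sum>j<N * M. if j \<in> enc ` X then emb (T (e (dec j))) i * f (dec j) else 0)"
        by (intro sum.cong) (auto simp: G_def emb_def)
      also have "\<dots> = (\<Sum>y\<in>X. emb (T (e y)) i * f y)"
        unfolding sum_enc by (intro sum.cong) auto
      also have "\<dots> = emb (T f) i"
      proof (cases "i \<in> enc ` X")
        case True
        then show ?thesis using Tf by (auto simp: mult.commute)
      qed (simp add: emb_def)
      finally show ?thesis .
    next
      case False
      then have "i \<notin> enc ` X" using enc_less by auto
      then show ?thesis using False by (simp add: apply_fn_def emb_def)
    qed
  qed
  ultimately show ?thesis by blast
qed

text \<open>The step list is chosen before \<open>U\<close>, so it cannot depend on the unknown
  unitary; its action is specified on encoded states.\<close>

definition realises :: "nat \<Rightarrow> ((nat \<Rightarrow> nat \<Rightarrow> complex) \<Rightarrow> (index \<Rightarrow> complex) \<Rightarrow> index \<Rightarrow> complex) \<Rightarrow> bool" where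
  "realises c F \<longleftrightarrow> (\<exists>ss. (\<forall>G. Gate G \<in> set ss \<longrightarrow> unitary_fn (N * M) G) \<and>
     length (filter is_query ss) = c \<and>
     (\<forall>U. unitary_fn N U \<longrightarrow> (\<forall>f. fold (step_apply N M U) ss (emb f) = emb (F U f))))"

lemma realises_cong:
  assumes "realises c F"
    and "\<And>U f x. unitary_fn N U \<Longrightarrow> x \<in> X \<Longrightarrow> F U f x = F' U f x"
  shows "realises c F'"
proof -
  have "emb (F U f) = emb (F' U f)" if "unitary_fn N U" for U f
    using assms(2) that by (intro emb_cong) auto
  then show ?thesis using assms(1) unfolding realises_def by metis
qed

lemma realises_comp:
  assumes "realises c F" "realises c' F'"
  shows "realises (c + c') (\<lambda>U f. F' U (F U f))"
proof -
  obtain ss where ss: "\<forall>G. Gate G \<in> set ss \<longrightarrow> unitary_fn (N * M) G"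
     "length (filter is_query ss) = c"
     "\<forall>U. unitary_fn N U \<longrightarrow> (\<forall>f. fold (step_apply N M U) ss (emb f) = emb (F U f))"
    using assms(1) unfolding realises_def by blast
  obtain ss' where ss': "\<forall>G. Gate G \<in> set ss' \<longrightarrow> unitary_fn (N * M) G"
     "length (filter is_query ss') = c'"
     "\<forall>U. unitary_fn N U \<longrightarrow> (\<forall>f. fold (step_apply N M U) ss' (emb f) = emb (F' U f))"
    using assms(2) unfolding realises_def by blast
  show ?thesis
    unfolding realises_def
    by (rule exI[of _ "ss @ ss'"]) (use ss ss' in auto)
qed

lemma realises_id: "realises 0 (\<lambda>U f. f)"
  unfolding realises_def by (rule exI[of _ "[]"]) auto

lemma realises_funpow:
  assumes "realises c F"
  shows "realises (t * c) (\<lambda>U. F U ^^ t)"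
proof (induction t)
  case 0
  show ?case using realises_id by (simp add: id_def)
next
  case (Suc t)
  show ?case using realises_comp[OF Suc assms] by (simp add: add.commute o_def)
qed

lemma realises_isometry:
  assumes "isometry_on X T"
  shows "realises 0 (\<lambda>U. T)"
proof -
  obtain G where "unitary_fn (N * M) G" "\<forall>f. apply_fn (N * M) G (emb f) = emb (T f)"
    using gate_of_isometry[OF assms] by blast
  then show ?thesis
    unfolding realises_def by (intro exI[of _ "[Gate G]"]) auto
qed

lemma realises_query: "realises 1 query_op"
  unfolding realises_def by (rule exI[of _ "[QueryU]"]) (auto simp: controlled_apply_emb)

lemma realises_query_adjoint: "realises 1 (\<lambda>U. query_op (adjoint_fn U))"
  unfolding realises_def by (rule exI[of _ "[QueryUdag]"]) (auto simp: controlled_apply_emb)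

end

section \<open>Counter weights\<close>

text \<open>The weights are the distribution of a sum of \<open>r\<close> independent uniform
  variables on \<open>{..<L}\<close>, and the identity is their generating function. The bound on
  \<open>K\<close> leaves room for the degree.\<close>

lemma fejer_weights:
  fixes L r K :: nat
  assumes "L \<ge> 1" "r * L < K"
  obtains p :: "nat \<Rightarrow> real" where "\<And>k. p k \<ge> 0"
    and "\<And>z::complex. (\<Sum>k<K. of_real (p k) * z ^ k) = ((\<Sum>j<L. z ^ j) / of_nat L) ^ r"
proof -
  define q where "q = (\<Sum>j<L. monom (1 / of_nat L) j :: complex poly)"
  have coeff_q: "coeff q k = (if k < L then of_real (1 / real L) else 0)" for k
    by (simp add: q_def coeff_sum)
  have nonneg: "Im (coeff (q ^ r) k) = 0 \<and> Re (coeff (q ^ r) k) \<ge> 0" for k r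
  proof (induction r arbitrary: k)
    case 0
    then show ?case by (simp add: coeff_1)
  next
    case (Suc r)
    have "Im (coeff q k) = 0 \<and> Re (coeff q k) \<ge> 0" for k
      by (simp add: coeff_q)
    then show ?case
      using Suc by (auto simp: coeff_mult intro!: sum_nonneg)
  qed
  have "degree q \<le> L"
    by (rule degree_le) (simp add: coeff_q)
  then have "degree (q ^ r) \<le> r * L"
    by (metis degree_power_le mult.commute mult_le_mono1 order_trans)
  then have deg: "degree (q ^ r) < K" using assms(2) by simp
  define p where "p k = Re (coeff (q ^ r) k)" for k
  have p: "of_real (p k) = coeff (q ^ r) k" for k
    using nonneg[of r k] by (simp add: p_def complex_eq_iff)
  have sum_p: "(\<Sum>k<K. of_real (p k) * z ^ k) = ((\<Sum>j<L. z ^ j) / of_nat L) ^ r" for z :: complex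
  proof -
    have "(\<Sum>k<K. of_real (p k) * z ^ k) = (\<Sum>k\<le>degree (q ^ r). coeff (q ^ r) k * z ^ k)"
      unfolding p using deg by (intro sum.mono_neutral_right) (auto intro: coeff_eq_0)
    also have "\<dots> = poly q z ^ r"
      by (simp add: poly_altdef[symmetric])
    also have "poly q z = (\<Sum>j<L. z ^ j) / of_nat L"
      by (simp add: q_def poly_sum poly_monom sum_divide_distrib)
    finally show ?thesis .
  qed
  show ?thesis
    by (rule that[of p, OF _ sum_p]) (use nonneg in \<open>simp add: p_def\<close>)
qed

text \<open>The geometric sum is at most \<open>2 / cmod (1 - z)\<close> in modulus, so its mean is
  at most one half as soon as \<open>L\<close> is four times the inverse distance.\<close>

lemma norm_geometric_mean_le_half:
  fixes z :: complex
  assumes "cmod z = 1" "4 \<le> real L * cmod (1 - z)"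
  shows "cmod (((\<Sum>j<L. z ^ j) / of_nat L) ^ r) \<le> (1 / 2) ^ r"
proof -
  have L: "real L > 0" and z: "cmod (1 - z) > 0"
    using assms(2) by (auto intro: gr0I)
  then have "z \<noteq> 1" by auto
  then have "(\<Sum>j<L. z ^ j) = (1 - z ^ L) / (1 - z)"
    by (simp add: sum_gp_strict)
  then have "cmod ((\<Sum>j<L. z ^ j) / of_nat L) = cmod (1 - z ^ L) / (cmod (1 - z) * real L)"
    by (simp add: norm_divide norm_mult)
  also have "\<dots> \<le> 2 / (cmod (1 - z) * real L)"
  proof -
    have "cmod (1 - z ^ L) \<le> cmod 1 + cmod (z ^ L)" by (rule norm_triangle_ineq4)
    then have "cmod (1 - z ^ L) \<le> 2" using assms(1) by (simp add: norm_power)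
    then show ?thesis using L z by (intro divide_right_mono) auto
  qed
  also have "\<dots> \<le> 1 / 2" using assms(2) L z by (simp add: field_simps)
  finally show ?thesis unfolding norm_power by (intro power_mono) auto
qed

section \<open>Grover rotations\<close>

text \<open>For \<open>c = sin \<theta>\<close> with \<theta> between -pi/2 and pi/2 this is exp(i
  \<theta>).\<close>

definition phase :: "real \<Rightarrow> complex" where "phase c = Complex (sqrt (1 - c\<^sup>2)) c"

lemma norm_phase: "\<bar>c\<bar> \<le> 1 \<Longrightarrow> cmod (phase c) = 1"
  by (simp add: phase_def complex_norm abs_square_le_1)

lemma sqrt_ge_half: "\<bar>c\<bar> \<le> 1 / 2 \<Longrightarrow> sqrt (1 - c\<^sup>2) \<ge> 1 / 2"
proof -
  assume "\<bar>c\<bar> \<le> 1 / 2"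
  then have "c\<^sup>2 \<le> (1 / 2)\<^sup>2" by (metis abs_ge_zero power2_abs power_mono)
  then show ?thesis by (intro real_le_rsqrt) (simp add: power2_eq_square)
qed

text \<open>The difference of squares factors. The difference factor is bounded below by its
  imaginary part, the sum factor by its real part, to which each square root contributes at least
  one half.\<close>

lemma phase_separation:
  assumes "\<bar>c\<bar> \<le> 1 / 2" "\<bar>c'\<bar> \<le> 1 / 2"
  shows "\<bar>c - c'\<bar> \<le> cmod ((phase c)\<^sup>2 - (phase c')\<^sup>2)"
proof -
  have "\<bar>c - c'\<bar> \<le> cmod (phase c - phase c')"
    using abs_Im_le_cmod[of "phase c - phase c'"] by (simp add: phase_def)
  moreover have "1 \<le> cmod (phase c + phase c')"
    using complex_Re_le_cmod[of "phase c + phase c'"] sqrt_ge_half[OF assms(1)] sqrt_ge_half[OF assms(2)]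
    by (simp add: phase_def)
  ultimately have "\<bar>c - c'\<bar> * 1 \<le> cmod (phase c - phase c') * cmod (phase c + phase c')"
    by (intro mult_mono) auto
  also have "\<dots> = cmod ((phase c)\<^sup>2 - (phase c')\<^sup>2)"
    by (simp add: norm_mult[symmetric] algebra_simps power2_eq_square)
  finally show ?thesis by simp
qed

definition grover :: "'i set \<Rightarrow> ('i \<Rightarrow> complex) \<Rightarrow> ('i \<Rightarrow> complex) \<Rightarrow> ('i \<Rightarrow> complex) \<Rightarrow> 'i \<Rightarrow> complex" where
  "grover P \<Psi> w f = reflect P \<Psi> (reflect P w f)"

definition grover_inv :: "'i set \<Rightarrow> ('i \<Rightarrow> complex) \<Rightarrow> ('i \<Rightarrow> complex) \<Rightarrow> ('i \<Rightarrow> complex) \<Rightarrow> 'i \<Rightarrow> complex" where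
  "grover_inv P \<Psi> w f = reflect P w (reflect P \<Psi> f)"

text \<open>The component of \<open>\<Psi>\<close> in the eigenspace for \<open>-(phase c)\<^sup>2\<close>; replacing \<open>(w, c)\<close> by \<open>(-w, -c)\<close> gives
  the component for the conjugate eigenvalue.\<close>

definition eigenpart :: "('i \<Rightarrow> complex) \<Rightarrow> ('i \<Rightarrow> complex) \<Rightarrow> real \<Rightarrow> 'i \<Rightarrow> complex" where
  "eigenpart \<Psi> w c = (\<lambda>p. phase c / of_real (2 * sqrt (1 - c\<^sup>2)) * \<Psi> p
     + - \<i> / of_real (2 * sqrt (1 - c\<^sup>2)) * w p)"

text \<open>The case \<open>w = 0\<close> covers unmarked states and forces \<open>c = 0\<close>.
  The bound on \<open>c\<close> keeps the denominator of \<open>eigenpart\<close> at least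
  1.\<close>

locale grover_pair =
  fixes P :: "'i set" and \<Psi> w :: "'i \<Rightarrow> complex" and c :: real
  assumes unit: "ip P \<Psi> \<Psi> = 1" and unit_or_zero: "ip P w w = 1 \<or> w = (\<lambda>_. 0)"
    and overlap: "ip P w \<Psi> = of_real c" and small: "\<bar>c\<bar> \<le> 1 / 2"
begin

lemma isometry_grover: "isometry_on P (grover P \<Psi> w)"
  unfolding grover_def
  by (rule isometry_on_comp[OF isometry_on_reflect isometry_on_reflect]) (use unit unit_or_zero in auto)

lemma isometry_grover_inv: "isometry_on P (grover_inv P \<Psi> w)"
  unfolding grover_inv_def
  by (rule isometry_on_comp[OF isometry_on_reflect isometry_on_reflect]) (use unit unit_or_zero in auto)

lemma grover_inv_grover: "grover_inv P \<Psi> w (grover P \<Psi> w f) = f"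
  unfolding grover_inv_def grover_def using unit unit_or_zero by (simp add: reflect_reflect)

lemma grover_inv_funpow: "(grover_inv P \<Psi> w ^^ k) ((grover P \<Psi> w ^^ k) f) = f"
proof (induction k arbitrary: f)
  case (Suc k)
  have "(grover_inv P \<Psi> w ^^ Suc k) ((grover P \<Psi> w ^^ Suc k) f)
     = (grover_inv P \<Psi> w ^^ k) (grover_inv P \<Psi> w (grover P \<Psi> w ((grover P \<Psi> w ^^ k) f)))"
    by (simp add: funpow_swap1)
  then show ?case by (simp add: grover_inv_grover Suc)
qed simp

text \<open>In this non-orthogonal basis the matrix has determinant 1 and trace 4c^2 - 2, which is
  -2 cos(2 \<theta>) for \<open>c = sin \<theta>\<close>; hence the eigenvalues -exp(2i \<theta>)
  and -exp(-2i \<theta>).\<close>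

lemma grover_plane:
  "grover P \<Psi> w (\<lambda>p. \<alpha> * \<Psi> p + \<beta> * w p) =
    (\<lambda>p. ((4 * of_real c ^ 2 - 1) * \<alpha> + 2 * of_real c * \<beta>) * \<Psi> p + (- 2 * of_real c * \<alpha> - \<beta>) * w p)"
proof -
  have o: "ip P \<Psi> w = of_real c"
    using ip_commute[of P \<Psi> w] overlap by simp
  have 1: "reflect P w (\<lambda>p. \<alpha> * \<Psi> p + \<beta> * w p) = (\<lambda>p. \<alpha> * \<Psi> p + (- 2 * of_real c * \<alpha> - \<beta>) * w p)"
    using unit_or_zero unfolding reflect_def ip_linear overlap
    by (auto simp: algebra_simps)
  show ?thesis
    unfolding grover_def 1 unfolding reflect_def ip_linear o unit
    by (simp add: algebra_simps power2_eq_square)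
qed

lemma sqrt_pos: "sqrt (1 - c\<^sup>2) > 0"
  using sqrt_ge_half[OF small] by linarith

lemma phase_sq: "(phase c)\<^sup>2 = 2 * \<i> * of_real c * phase c + 1"
proof -
  have "sqrt (1 - c\<^sup>2) * sqrt (1 - c\<^sup>2) = 1 - c\<^sup>2"
    using sqrt_pos by simp
  then show ?thesis
    by (simp add: phase_def complex_eq_iff power2_eq_square)
qed

text \<open>Comparing the coefficients of \<Psi> and \<open>w\<close> leaves two scalar identities
  in \<open>u = phase c\<close>, both consequences of the quadratic equation
  \<open>phase_sq\<close>.\<close>

lemma grover_eigenpart:
  "grover P \<Psi> w (eigenpart \<Psi> w c) = (\<lambda>p. - (phase c)\<^sup>2 * eigenpart \<Psi> w c p)"
proof -
  define d where "d = complex_of_real (2 * sqrt (1 - c\<^sup>2))"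
  define u where "u = phase c"
  have d: "d \<noteq> 0" using sqrt_pos by (simp add: d_def)
  have u2: "u\<^sup>2 = 2 * \<i> * of_real c * u + 1" using phase_sq by (simp add: u_def)
  have "u\<^sup>2 * u = (2 * \<i> * of_real c * u + 1) * u"
    by (simp only: u2)
  also have "\<dots> = 2 * \<i> * of_real c * u\<^sup>2 + u"
    by (simp add: algebra_simps power2_eq_square)
  also have "\<dots> = - 4 * of_real c ^ 2 * u + 2 * \<i> * of_real c + u"
    unfolding u2 by (simp add: algebra_simps power2_eq_square)
  finally have u3: "u\<^sup>2 * u = - 4 * of_real c ^ 2 * u + 2 * \<i> * of_real c + u" .
  have 1: "(4 * of_real c ^ 2 - 1) * (u / d) + 2 * of_real c * (- \<i> / d) = - (u\<^sup>2) * (u / d)"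
  proof -
    have "(4 * of_real c ^ 2 - 1) * u + 2 * of_real c * (- \<i>) = - (u\<^sup>2) * u"
      using u3 by (simp add: algebra_simps)
    then show ?thesis by (metis times_divide_eq_right add_divide_distrib)
  qed
  have 2: "- 2 * of_real c * (u / d) - (- \<i> / d) = - u\<^sup>2 * (- \<i> / d)"
    unfolding u2 by (simp add: diff_divide_distrib add_divide_distrib algebra_simps)
  show ?thesis
    unfolding eigenpart_def grover_plane u_def[symmetric] d_def[symmetric] 1 2
    by (simp only: distrib_left mult.assoc)
qed

lemma norm_eigenpart: "cmod (eigenpart \<Psi> w c p) \<le> cmod (\<Psi> p) + cmod (w p)"
proof -
  define d where "d = 2 * sqrt (1 - c\<^sup>2)"
  have d: "d \<ge> 1" using sqrt_ge_half[OF small] by (simp add: d_def)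
  have "cmod (eigenpart \<Psi> w c p) \<le> cmod (phase c / of_real d * \<Psi> p) + cmod (- \<i> / of_real d * w p)"
    unfolding eigenpart_def d_def by (rule norm_triangle_ineq)
  also have "\<dots> = cmod (\<Psi> p) / d + cmod (w p) / d"
    using d small by (simp add: norm_mult norm_divide norm_phase)
  also have "\<dots> \<le> cmod (\<Psi> p) + cmod (w p)"
    using d by (intro add_mono) (simp_all add: divide_le_eq mult_left_le mult_le_cancel_left1)
  finally show ?thesis .
qed

lemma grover_pair_minus: "grover_pair P \<Psi> (\<lambda>p. - w p) (- c)"
proof
  show "ip P \<Psi> \<Psi> = 1" by (rule unit)
  show "ip P (\<lambda>p. - w p) (\<lambda>p. - w p) = 1 \<or> (\<lambda>p. - w p) = (\<lambda>_. 0)"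
    using unit_or_zero by (auto simp: ip_def)
  show "ip P (\<lambda>p. - w p) \<Psi> = of_real (- c)"
    using overlap by (simp add: ip_def sum_negf)
  show "\<bar>- c\<bar> \<le> 1 / 2" using small by simp
qed

lemma grover_minus: "grover P \<Psi> (\<lambda>p. - w p) = grover P \<Psi> w"
proof -
  have r: "reflect P (\<lambda>p. - w p) f = reflect P w f" for f
    by (simp add: reflect_def ip_def sum_negf)
  show ?thesis by (intro ext) (simp add: grover_def r)
qed

text \<open>The two eigenparts add up to \<Psi>: their \<open>w\<close> terms cancel, and
  \<open>phase c + phase (- c)\<close> is the common denominator. Negating \<open>w\<close> leaves
  \<open>grover\<close> unchanged, so both are eigenvectors of the same operator.\<close>

lemma grover_funpow:
  "(grover P \<Psi> w ^^ k) \<Psi> = (\<lambda>p. (- (phase c)\<^sup>2) ^ k * eigenpart \<Psi> w c p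
     + (- (phase (- c))\<^sup>2) ^ k * eigenpart \<Psi> (\<lambda>p. - w p) (- c) p)"
proof (induction k)
  case 0
  define d where "d = complex_of_real (2 * sqrt (1 - c\<^sup>2))"
  have d: "d \<noteq> 0" using sqrt_pos by (simp add: d_def)
  have "phase c + phase (- c) = d" by (simp add: phase_def d_def complex_eq_iff)
  then have "phase c / d + phase (- c) / d = 1" using d by (simp add: add_divide_distrib[symmetric])
  then have 1: "phase c / d * \<Psi> p + phase (- c) / d * \<Psi> p = \<Psi> p" for p
    by (simp only: distrib_right[symmetric] mult_1)
  have "(\<lambda>p. eigenpart \<Psi> w c p + eigenpart \<Psi> (\<lambda>p. - w p) (- c) p) =
      (\<lambda>p. phase c / d * \<Psi> p + phase (- c) / d * \<Psi> p)"
    unfolding eigenpart_def power2_minus d_def[symmetric] by simp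
  then show ?case unfolding 1 by simp
next
  case (Suc k)
  interpret m: grover_pair P \<Psi> "\<lambda>p. - w p" "- c" by (rule grover_pair_minus)
  note lin = isometry_on_add[OF isometry_grover] isometry_on_scale[OF isometry_grover]
  have "(grover P \<Psi> w ^^ Suc k) \<Psi> = grover P \<Psi> w ((grover P \<Psi> w ^^ k) \<Psi>)" by simp
  also have "\<dots> = (\<lambda>p. (- (phase c)\<^sup>2) ^ k * grover P \<Psi> w (eigenpart \<Psi> w c) p
     + (- (phase (- c))\<^sup>2) ^ k * grover P \<Psi> w (eigenpart \<Psi> (\<lambda>p. - w p) (- c)) p)"
    unfolding Suc lin ..
  finally show ?case
    using m.grover_eigenpart unfolding grover_eigenpart grover_minus by (simp add: mult_ac)
qed

text \<open>The coefficient of \<Psi> is a multiple of the cosine of (2T+1) \<theta>, which vanishes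
  at pi/2, so the iteration lands exactly on \<open>w\<close>. The sign comes from the minus in the
  eigenvalues.\<close>

lemma grover_funpow_quarter_turn:
  assumes "c = sin \<theta>" "cos \<theta> > 0" "real (2 * T + 1) * \<theta> = pi / 2"
  shows "(grover P \<Psi> w ^^ T) \<Psi> = (\<lambda>p. (- 1) ^ T * w p)"
proof -
  have sq: "sqrt (1 - c\<^sup>2) = cos \<theta>"
    using assms(1,2) by (metis cos_squared_eq less_imp_le real_sqrt_unique)
  have ph: "phase c = cis \<theta>" "phase (- c) = cis (- \<theta>)"
    using sq by (simp_all add: phase_def assms(1) complex_eq_iff)
  have pw: "(- (phase c)\<^sup>2) ^ T = (- 1) ^ T * cis (2 * T * \<theta>)"
     "(- (phase (- c))\<^sup>2) ^ T = (- 1) ^ T * cis (- (2 * T * \<theta>))"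
    unfolding ph by (subst power_minus, simp add: DeMoivre mult_ac)+
  define C where "C = complex_of_real (2 * cos \<theta>)"
  have C: "C \<noteq> 0" using assms(2) by (simp add: C_def)
  have a: "2 * T * \<theta> + \<theta> = pi / 2" using assms(3) by (simp add: algebra_simps)
  have 1: "cis (2 * T * \<theta>) * cis \<theta> = \<i>" "cis (- (2 * T * \<theta>)) * cis (- \<theta>) = - \<i>"
  proof -
    show "cis (2 * T * \<theta>) * cis \<theta> = \<i>" unfolding cis_mult a by (simp add: cis_pi_half)
    have "- (2 * T * \<theta>) + - \<theta> = - (pi / 2)" using a by linarith
    then show "cis (- (2 * T * \<theta>)) * cis (- \<theta>) = - \<i>"
      unfolding cis_mult by (simp add: complex_eq_iff)
  qed
  have "2 * T * \<theta> = pi / 2 - \<theta>" using a by linarith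
  then have 2: "\<i> * cis (- (2 * T * \<theta>)) - \<i> * cis (2 * T * \<theta>) = C"
    by (simp add: complex_eq_iff C_def sin_diff cos_diff)
  have "(grover P \<Psi> w ^^ T) \<Psi> p = (- 1) ^ T * w p" for p
  proof -
    have "(grover P \<Psi> w ^^ T) \<Psi> p = (- 1) ^ T * (((cis (2 * T * \<theta>) * cis \<theta> + cis (- (2 * T * \<theta>)) * cis (- \<theta>)) * \<Psi> p
       + (\<i> * cis (- (2 * T * \<theta>)) - \<i> * cis (2 * T * \<theta>)) * w p) / C)"
      unfolding grover_funpow pw unfolding eigenpart_def ph power2_minus sq C_def[symmetric]
      by (simp add: algebra_simps add_divide_distrib diff_divide_distrib)
    then show ?thesis unfolding 1 2 using C by simp
  qed
  then show ?thesis by blast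
qed

end

text \<open>A vector almost orthogonal to \<open>A\<close> and \<open>B\<close> is hardly moved: the
  first reflection costs 2 \<epsilon>, the second 2 * 3 \<epsilon>. The bound is pointwise in
  \<open>k\<close> so that it can be multiplied by the amplitudes of the other registers and then
  summed.\<close>

lemma two_reflections_near_identity:
  assumes A: "\<And>k. cmod (A k) = a k" "\<And>k. cmod (B k) = a k"
    and "cmod (ip Y B A) \<le> \<epsilon>" "\<epsilon> \<le> 1" "cmod (ip Y A b) \<le> \<epsilon>" "cmod (ip Y B b) \<le> \<epsilon>"
  shows "cmod (reflect Y B (reflect Y A b) k - b k) \<le> 8 * \<epsilon> * a k"
proof -
  have a0: "a k \<ge> 0" using A(1)[of k] norm_ge_zero by metis
  define x where "x = ip Y A b"
  define y where "y = ip Y B b - 2 * x * ip Y B A"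
  have "reflect Y B (reflect Y A b) k - b k = - (2 * x * A k) - 2 * y * B k"
    unfolding reflect_def ip_linear x_def y_def by simp
  then have "cmod (reflect Y B (reflect Y A b) k - b k) \<le> cmod (2 * x * A k) + cmod (2 * y * B k)"
    by (metis norm_minus_cancel norm_triangle_ineq4)
  also have "\<dots> = (2 * cmod x + 2 * cmod y) * a k"
    by (simp add: norm_mult A algebra_simps)
  also have "\<dots> \<le> 8 * \<epsilon> * a k"
  proof (intro mult_right_mono a0)
    have "cmod y \<le> cmod (ip Y B b) + cmod (2 * x * ip Y B A)"
      unfolding y_def by (rule norm_triangle_ineq4)
    also have "\<dots> = cmod (ip Y B b) + 2 * (cmod x * cmod (ip Y B A))"
      by (simp add: norm_mult)
    also have "\<dots> \<le> \<epsilon> + 2 * (\<epsilon> * 1)"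
      using assms(3-6) norm_ge_zero[of x] unfolding x_def
      by (intro add_mono mult_left_mono mult_mono) (auto intro: order_trans[OF norm_ge_zero])
    finally show "2 * cmod x + 2 * cmod y \<le> 8 * \<epsilon>"
      using assms(5) by (simp add: x_def)
  qed
  finally show ?thesis .
qed

text \<open>The first reflection negates \<open>A\<close> exactly, after which the second adds twice
  the overlap times \<open>B\<close>. Starting from \<open>B\<close>, the defect consists of one
  term linear and one quadratic in the overlap.\<close>

lemma two_reflections_near_minus_identity:
  assumes A: "\<And>k. cmod (A k) = a k" "\<And>k. cmod (B k) = a k"
    and "ip Y A A = 1" "ip Y B B = 1" "cmod (ip Y B A) \<le> \<epsilon>" "\<epsilon> \<le> 1"
  shows "cmod (reflect Y B (reflect Y A A) k + A k) \<le> 8 * \<epsilon> * a k"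
    and "cmod (reflect Y B (reflect Y A B) k + B k) \<le> 8 * \<epsilon> * a k"
proof -
  have a0: "a k \<ge> 0" using A(1)[of k] norm_ge_zero by metis
  have e0: "\<epsilon> \<ge> 0" using assms(5) norm_ge_zero order_trans by blast
  define x where "x = ip Y B A"
  have x: "ip Y A B = cnj x" unfolding x_def by (rule ip_commute)
  have xe: "cmod x \<le> \<epsilon>" using assms(5) by (simp add: x_def)
  have "reflect Y A A = (\<lambda>k. - 1 * A k)" unfolding reflect_def assms(3) by (simp add: algebra_simps)
  then have "reflect Y B (reflect Y A A) k + A k = 2 * x * B k"
    unfolding reflect_def[of Y B] by (simp only: ip_scale_right x_def) simp
  then have "cmod (reflect Y B (reflect Y A A) k + A k) = 2 * cmod x * a k"
    by (simp add: norm_mult A)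
  also have "\<dots> \<le> 8 * \<epsilon> * a k"
    using xe e0 by (intro mult_right_mono a0) linarith
  finally show "cmod (reflect Y B (reflect Y A A) k + A k) \<le> 8 * \<epsilon> * a k" .
  have "reflect Y B (reflect Y A B) k + B k = 4 * cnj x * x * B k - 2 * cnj x * A k"
    unfolding reflect_def ip_linear x assms(4) by (simp add: x_def algebra_simps)
  then have "cmod (reflect Y B (reflect Y A B) k + B k) \<le> cmod (4 * cnj x * x * B k) + cmod (2 * cnj x * A k)"
    by (metis norm_triangle_ineq4)
  also have "\<dots> = (4 * (cmod x * cmod x) + 2 * cmod x) * a k"
    by (simp add: norm_mult A algebra_simps)
  also have "\<dots> \<le> 8 * \<epsilon> * a k"
  proof (intro mult_right_mono a0)
    have "cmod x * cmod x \<le> \<epsilon> * 1" using xe assms(6) e0 by (intro mult_mono) auto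
    then show "4 * (cmod x * cmod x) + 2 * cmod x \<le> 8 * \<epsilon>" using xe e0 by simp
  qed
  finally show "cmod (reflect Y B (reflect Y A B) k + B k) \<le> 8 * \<epsilon> * a k" .
qed

section \<open>The search circuit\<close>

text \<open>\<open>U\<close> is no parameter here: the circuit is built only from quantities
  computable from the given amplitude, gap and error probability.\<close>

locale search = workspace +
  fixes s c1 :: real and a :: "nat \<Rightarrow> real"
  assumes s_range: "0 \<le> s" "s \<le> 1" and c1_range: "0 < c1" "c1 \<le> 1 / 2"
    and a_nonneg: "\<And>k. a k \<ge> 0" and a_unit: "(\<Sum>k<K. (a k)\<^sup>2) = 1"
begin

section \<open>Prepared states and counter waves\<close>

definition flag :: "bool \<Rightarrow> complex" where
  "flag b = of_real (if b then s else sqrt (1 - s\<^sup>2))"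

definition \<beta> :: "nat \<times> bool \<Rightarrow> complex" where
  "\<beta> = (\<lambda>(y, b). if y = 0 then flag b else 0)"

definition \<Psi> :: "(nat \<Rightarrow> nat \<Rightarrow> complex) \<Rightarrow> nat \<times> bool \<Rightarrow> complex" where
  "\<Psi> U = (\<lambda>(y, b). U y 0 * flag b)"

text \<open>Only basis states whose flag is set are marked; for all others the vector is zero, so that reflecting
  about it does nothing and the corresponding Grover operator has angle \<open>0\<close>.\<close>

definition ket :: "nat \<times> bool \<Rightarrow> nat \<times> bool \<Rightarrow> complex" where
  "ket q = (\<lambda>p. if q \<in> P \<and> snd q \<and> p = q then 1 else 0)"

definition wave :: "complex \<Rightarrow> nat \<Rightarrow> complex" where
  "wave \<mu> = (\<lambda>k. of_real (a k) * \<mu> ^ k)"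

text \<open>The counter state left by the Grover powers on the eigenpart of amplitude
  \<open>c\<close>; \<open>- c\<close> stands for the conjugate eigenvalue.\<close>

definition target :: "real \<Rightarrow> nat \<Rightarrow> complex" where
  "target c = wave (- (phase c)\<^sup>2)"

definition P_query :: "(nat \<Rightarrow> nat \<Rightarrow> complex) \<Rightarrow> (nat \<times> bool \<Rightarrow> complex) \<Rightarrow> nat \<times> bool \<Rightarrow> complex" where
  "P_query V = slice1 (\<lambda>_. mat_op N V)"

lemma query_op_eq: "query_op V = slice1 (\<lambda>_. P_query V)"
  by (simp add: query_op_def P_query_def)

lemma isometry_P_query: "unitary_fn N V \<Longrightarrow> isometry_on P (P_query V)"
  unfolding P_def P_query_def by (intro isometry_on_slice1 isometry_on_mat_op)

lemma P_query_scale: "P_query V (\<lambda>p. c * f p) = (\<lambda>p. c * P_query V f p)"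
  by (auto simp: P_query_def mat_op_def sum_distrib_left mult_ac fun_eq_iff)

lemma P_query_adjoint: "unitary_fn N U \<Longrightarrow> p \<in> P \<Longrightarrow> P_query U (P_query (adjoint_fn U) f) p = f p"
  by (cases p) (simp add: P_query_def P_def mat_op_adjoint)

lemma P_query_beta: "P_query U \<beta> = \<Psi> U"
proof
  fix p :: "nat \<times> bool"
  obtain y b where p: "p = (y, b)" by (cases p)
  have "P_query U \<beta> p = (\<Sum>j<N. if j = 0 then U y 0 * flag b else 0)"
    unfolding p by (simp add: P_query_def mat_op_def \<beta>_def if_distrib cong: if_cong)
  then show "P_query U \<beta> p = \<Psi> U p" by (simp add: p \<Psi>_def)
qed

lemma ip_P_query_adjoint: "ip P f (P_query (adjoint_fn U) g) = ip P (P_query U f) g"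
  unfolding P_def ip_Times1 P_query_def by (simp add: ip_mat_op_adjoint)

lemma flag_unit: "cnj (flag True) * flag True + cnj (flag False) * flag False = 1"
proof -
  have "s\<^sup>2 \<le> 1" using s_range by (simp add: power_le_one)
  then have "s * s + sqrt (1 - s\<^sup>2) * sqrt (1 - s\<^sup>2) = 1"
    by (simp add: power2_eq_square)
  then show ?thesis unfolding flag_def
    by (simp flip: of_real_mult of_real_add)
qed

lemma beta_unit: "ip P \<beta> \<beta> = 1"
proof -
  have "ip {..<N} (\<lambda>y. \<beta> (y, b)) (\<lambda>y. \<beta> (y, b)) = cnj (flag b) * flag b" for b
  proof -
    have "ip {..<N} (\<lambda>y. \<beta> (y, b)) (\<lambda>y. \<beta> (y, b)) = (\<Sum>y<N. if y = 0 then cnj (flag b) * flag b else 0)"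
      unfolding ip_def by (rule sum.cong) (auto simp: \<beta>_def)
    then show ?thesis by simp
  qed
  then show ?thesis
    unfolding P_def ip_Times1 UNIV_bool using flag_unit by (simp add: add.commute)
qed

lemma Psi_unit: "unitary_fn N U \<Longrightarrow> ip P (\<Psi> U) (\<Psi> U) = 1"
  using isometry_on_ip[OF isometry_P_query, of U \<beta> \<beta>] beta_unit by (simp add: P_query_beta)

lemma ip_ket: "ip P (ket q) f = (if q \<in> P \<and> snd q then f q else 0)"
proof -
  have "ip P (ket q) f = (\<Sum>p\<in>P. if p = q then (if q \<in> P \<and> snd q then f q else 0) else 0)"
    unfolding ip_def by (rule sum.cong) (auto simp: ket_def)
  then show ?thesis by simp
qed

lemma ket_unit: "ip P (ket q) (ket q) = 1 \<or> ket q = (\<lambda>_. 0)"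
proof (cases "q \<in> P \<and> snd q")
  case True
  then show ?thesis unfolding ip_ket by (simp add: ket_def)
next
  case False
  then show ?thesis by (auto simp: ket_def)
qed

text \<open>The reflection about the unknown state is a fixed reflection conjugated by
  \<open>U\<close>, at the price of two queries. Equality holds on \<open>P\<close> because
  \<open>mat_op\<close> is inverted only below \<open>N\<close>.\<close>

lemma reflect_beta_conj:
  assumes "unitary_fn N U" "p \<in> P"
  shows "P_query U (reflect P \<beta> (P_query (adjoint_fn U) f)) p = reflect P (\<Psi> U) f p"
proof -
  note iso = isometry_P_query[OF assms(1)]
  have "P_query U (reflect P \<beta> (P_query (adjoint_fn U) f)) =
      (\<lambda>p. P_query U (P_query (adjoint_fn U) f) p - 2 * ip P (\<Psi> U) f * \<Psi> U p)"
    unfolding reflect_def ip_P_query_adjoint P_query_beta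
    by (simp only: isometry_on_diff[OF iso] P_query_scale P_query_beta)
  then show ?thesis using assms by (simp add: P_query_adjoint reflect_def)
qed

section \<open>Counter-controlled powers of the Grover operators\<close>

definition cgrover :: "nat \<Rightarrow> (nat \<Rightarrow> nat \<Rightarrow> complex) \<Rightarrow> (index \<Rightarrow> complex) \<Rightarrow> index \<Rightarrow> complex" where
  "cgrover i U = slice1 (\<lambda>(q, k). if i \<le> k then grover P (\<Psi> U) (ket q) else (\<lambda>f. f))"

definition cgrover_inv :: "nat \<Rightarrow> (nat \<Rightarrow> nat \<Rightarrow> complex) \<Rightarrow> (index \<Rightarrow> complex) \<Rightarrow> index \<Rightarrow> complex" where
  "cgrover_inv i U = slice1 (\<lambda>(q, k). if i \<le> k then grover_inv P (\<Psi> U) (ket q) else (\<lambda>f. f))"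

lemma isometry_creflect:
  assumes "\<And>q. ip P (w q) (w q) = 1 \<or> w q = (\<lambda>_. 0)"
  shows "isometry_on X (slice1 (\<lambda>(q, k). if i \<le> k then reflect P (w q) else (\<lambda>f. f)))"
  unfolding X_def
  by (rule isometry_on_slice1) (auto simp: isometry_on_id intro!: isometry_on_reflect assms)

lemma P_if: "x \<in> X \<Longrightarrow> fst x \<in> P"
  by (auto simp: X_def)

text \<open>Only the two reflections are conditioned on the counter. Where they are switched off,
  the query and its adjoint cancel.\<close>

lemma realises_cgrover: "realises 2 (cgrover i)"
proof -
  note g1 = realises_isometry[OF isometry_creflect[of ket i, OF ket_unit]]
  have "isometry_on X (slice1 (\<lambda>(q, k). if i \<le> k then reflect P \<beta> else (\<lambda>f. f)))"
    by (rule isometry_creflect[of "\<lambda>_. \<beta>" i]) (simp add: beta_unit)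
  note g2 = realises_isometry[OF this]
  note r = realises_comp[OF realises_comp[OF realises_comp[OF g1 realises_query_adjoint] g2] realises_query]
  have "realises (0 + 1 + 0 + 1) (cgrover i)"
  proof (rule realises_cong[OF r])
    fix U f x assume "unitary_fn N U" "x \<in> X"
    then show "query_op U (slice1 (\<lambda>(q, k). if i \<le> k then reflect P \<beta> else (\<lambda>f. f))
        (query_op (adjoint_fn U) (slice1 (\<lambda>(q, k). if i \<le> k then reflect P (ket q) else (\<lambda>f. f)) f))) x
      = cgrover i U f x"
      by (cases x) (auto simp: query_op_eq cgrover_def grover_def reflect_beta_conj P_query_adjoint dest!: P_if)
  qed
  then show ?thesis by (simp add: numeral_2_eq_2)
qed

lemma realises_cgrover_inv: "realises 2 (cgrover_inv i)"
proof -
  note g1 = realises_isometry[OF isometry_creflect[of ket i, OF ket_unit]]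
  have "isometry_on X (slice1 (\<lambda>(q, k). if i \<le> k then reflect P \<beta> else (\<lambda>f. f)))"
    by (rule isometry_creflect[of "\<lambda>_. \<beta>" i]) (simp add: beta_unit)
  note g2 = realises_isometry[OF this]
  note r = realises_comp[OF realises_comp[OF realises_comp[OF realises_query_adjoint g2] realises_query] g1]
  have "realises (1 + 0 + 1 + 0) (cgrover_inv i)"
  proof (rule realises_cong[OF r])
    fix U f x assume U: "unitary_fn N U" and x: "x \<in> X"
    obtain p q k where xx: "x = (p, q, k)" by (metis surj_pair)
    have p: "p \<in> P" using x by (auto simp: xx X_def)
    show "slice1 (\<lambda>(q, k). if i \<le> k then reflect P (ket q) else (\<lambda>f. f))
       (query_op U (slice1 (\<lambda>(q, k). if i \<le> k then reflect P \<beta> else (\<lambda>f. f))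
        (query_op (adjoint_fn U) f))) x = cgrover_inv i U f x"
    proof (cases "i \<le> k")
      case True
      \<comment> \<open>Here the conjugated reflection is the inner one, and its formula is known
        only on \<open>P\<close>; \<open>isometry_on_cong\<close> carries it through the outer
        reflection.\<close>
      have "reflect P (ket q) (P_query U (reflect P \<beta> (P_query (adjoint_fn U) (\<lambda>p. f (p, q, k))))) p
         = reflect P (ket q) (reflect P (\<Psi> U) (\<lambda>p. f (p, q, k))) p"
        using U by (intro isometry_on_cong[OF isometry_on_reflect[OF ket_unit] finite_P _ p] reflect_beta_conj)
      then show ?thesis using True by (simp add: xx query_op_eq cgrover_inv_def grover_inv_def)
    next
      case False
      then show ?thesis using p U by (simp add: xx query_op_eq cgrover_inv_def P_query_adjoint)
    qed
  qed
  then show ?thesis by (simp add: numeral_2_eq_2)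
qed

definition evolve :: "(nat \<Rightarrow> nat \<Rightarrow> complex) \<Rightarrow> (index \<Rightarrow> complex) \<Rightarrow> index \<Rightarrow> complex" where
  "evolve U = slice1 (\<lambda>(q, k). grover P (\<Psi> U) (ket q) ^^ k)"

definition evolve_inv :: "(nat \<Rightarrow> nat \<Rightarrow> complex) \<Rightarrow> (index \<Rightarrow> complex) \<Rightarrow> index \<Rightarrow> complex" where
  "evolve_inv U = slice1 (\<lambda>(q, k). grover_inv P (\<Psi> U) (ket q) ^^ k)"

lemma slice1_comp: "slice1 S (slice1 T f) = slice1 (\<lambda>j. S j \<circ> T j) f"
  by (auto simp: fun_eq_iff)

text \<open>Unary counting: round \<open>i\<close> acts on the branches with
  \<open>i \<le> k\<close>, so after rounds 1 to \<open>j\<close> branch \<open>k\<close> carries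
  the power \<open>min k j\<close>. Counter values lie below \<open>K\<close>, so \<open>K\<close>
  rounds complete every power.\<close>

lemma realises_counted_power:
  assumes "\<And>i. realises c (\<lambda>U. slice1 (\<lambda>(q, k). if i \<le> k then T U q else (\<lambda>f. f)))"
  shows "realises (K * c) (\<lambda>U. slice1 (\<lambda>(q, k). T U q ^^ k))"
proof -
  have "realises (j * c) (\<lambda>U. slice1 (\<lambda>(q, k). T U q ^^ min k j))" for j
  proof (induction j)
    case 0
    show ?case
      by (rule realises_cong[of _ "\<lambda>U f. f"]) (auto simp: realises_id)
  next
    case (Suc j)
    have "realises (j * c + c) (\<lambda>U. slice1 (\<lambda>(q, k). T U q ^^ min k (Suc j)))"
    proof (rule realises_cong[OF realises_comp[OF Suc assms[of "Suc j"]]])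
      fix U f x
      have "(if Suc j \<le> k then T U q else (\<lambda>f. f)) \<circ> T U q ^^ min k j = T U q ^^ min k (Suc j)" for q k
        by (cases "Suc j \<le> k") (auto simp: min_def le_Suc_eq fun_eq_iff)
      then show "slice1 (\<lambda>(q, k). if Suc j \<le> k then T U q else (\<lambda>f. f))
           (slice1 (\<lambda>(q, k). T U q ^^ min k j) f) x = slice1 (\<lambda>(q, k). T U q ^^ min k (Suc j)) f x"
        unfolding slice1_comp by (simp add: case_prod_unfold)
    qed
    then show ?case by (simp add: add.commute)
  qed
  from this[of K] show ?thesis
    by (rule realises_cong) (auto simp: X_def min_def)
qed

lemma realises_evolve: "realises (K * 2) evolve"
  unfolding evolve_def[abs_def]
  by (rule realises_counted_power) (rule realises_cgrover[unfolded cgrover_def[abs_def]])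

lemma realises_evolve_inv: "realises (K * 2) evolve_inv"
  unfolding evolve_inv_def[abs_def]
  by (rule realises_counted_power) (rule realises_cgrover_inv[unfolded cgrover_inv_def[abs_def]])

text \<open>For nearly orthogonal targets this is close to the identity minus twice the projection
  onto their span, that is, a sign flip of both waves of the maximal amplitude.\<close>

definition filter_wave :: "(nat \<Rightarrow> complex) \<Rightarrow> nat \<Rightarrow> complex" where
  "filter_wave b = reflect {..<K} (target (- c1)) (reflect {..<K} (target c1) b)"

definition filter_op :: "(index \<Rightarrow> complex) \<Rightarrow> index \<Rightarrow> complex" where
  "filter_op = slice2 (\<lambda>_. slice2 (\<lambda>_. filter_wave))"

lemma ip_wave: "ip {..<K} (wave \<mu>) (wave \<nu>) = (\<Sum>k<K. of_real ((a k)\<^sup>2) * (cnj \<mu> * \<nu>) ^ k)"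
  by (simp add: ip_def wave_def power_mult_distrib power2_eq_square mult_ac)

lemma wave_unit: "cmod \<mu> = 1 \<Longrightarrow> ip {..<K} (wave \<mu>) (wave \<mu>) = 1"
proof -
  assume "cmod \<mu> = 1"
  then have "cnj \<mu> * \<mu> = 1"
    by (metis complex_norm_square mult.commute of_real_1 power_one)
  then show ?thesis
    using a_unit by (simp add: ip_wave flip: of_real_sum of_real_power)
qed

lemma norm_wave: "cmod \<mu> = 1 \<Longrightarrow> cmod (wave \<mu> k) = a k"
  using a_nonneg by (simp add: wave_def norm_mult norm_power)

lemma norm_phase_sq: "\<bar>c\<bar> \<le> 1 / 2 \<Longrightarrow> cmod (- (phase c)\<^sup>2) = 1"
  by (simp add: norm_power norm_phase)

lemma target_unit: "\<bar>c\<bar> \<le> 1 / 2 \<Longrightarrow> ip {..<K} (target c) (target c) = 1"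
  unfolding target_def by (intro wave_unit norm_phase_sq)

lemma norm_target: "\<bar>c\<bar> \<le> 1 / 2 \<Longrightarrow> cmod (target c k) = a k"
  unfolding target_def by (intro norm_wave norm_phase_sq)

lemma isometry_filter_wave: "isometry_on {..<K} filter_wave"
  unfolding filter_wave_def[abs_def]
  by (rule isometry_on_comp[OF isometry_on_reflect isometry_on_reflect])
     (use c1_range in \<open>simp_all add: target_unit\<close>)

lemma isometry_filter: "isometry_on X filter_op"
  unfolding X_def filter_op_def by (intro isometry_on_slice2 isometry_filter_wave)

text \<open>Queries reach only the first copy, so \<open>U\<close> acts on the second one by
  exchanging the copies.\<close>

definition swap :: "(index \<Rightarrow> complex) \<Rightarrow> index \<Rightarrow> complex" where
  "swap f = (\<lambda>(p, q, k). f (q, p, k))"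

lemma isometry_swap: "isometry_on X swap"
proof (rule isometry_onI)
  fix f g
  have "(\<lambda>(p, q, k). (q, p, k)) ` X = X"
    by (force simp: X_def image_iff)
  moreover have "inj_on (\<lambda>(p, q, k). (q, p, k)) X" by (auto simp: inj_on_def)
  ultimately show "ip X (swap f) (swap g) = ip X f g"
    unfolding ip_def swap_def
    by (metis (mono_tags, lifting) sum.reindex_cong case_prod_unfold)
qed (auto simp: swap_def)

definition diffuse :: "(nat \<Rightarrow> nat \<Rightarrow> complex) \<Rightarrow> (index \<Rightarrow> complex) \<Rightarrow> index \<Rightarrow> complex" where
  "diffuse U = slice2 (\<lambda>_. slice1 (\<lambda>_. reflect P (\<Psi> U)))"

lemma realises_diffuse: "realises 2 diffuse"
proof -
  have "isometry_on X (slice1 (\<lambda>_. reflect P \<beta>))"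
    unfolding X_def by (rule isometry_on_slice1) (simp add: isometry_on_reflect beta_unit)
  note g = realises_isometry[OF this] and w = realises_isometry[OF isometry_swap]
  note r = realises_comp[OF realises_comp[OF realises_comp[OF realises_comp[OF
      w realises_query_adjoint] g] realises_query] w]
  have "realises (0 + 1 + 0 + 1 + 0) diffuse"
  proof (rule realises_cong[OF r])
    fix U f x assume "unitary_fn N U" "x \<in> X"
    then show "swap (query_op U (slice1 (\<lambda>_. reflect P \<beta>) (query_op (adjoint_fn U) (swap f)))) x
        = diffuse U f x"
      by (cases x) (auto simp: X_def swap_def query_op_eq diffuse_def reflect_beta_conj)
  qed
  then show ?thesis by (simp add: numeral_2_eq_2)
qed

text \<open>Intended effect: one Grover step on the second copy towards the flagged best state, with
  the first copy and the counter returned to their start states.\<close>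

definition iterate :: "(nat \<Rightarrow> nat \<Rightarrow> complex) \<Rightarrow> (index \<Rightarrow> complex) \<Rightarrow> index \<Rightarrow> complex" where
  "iterate U f = diffuse U (evolve_inv U (filter_op (evolve U f)))"

lemma realises_iterate: "realises (4 * K + 2) iterate"
  using realises_comp[OF realises_comp[OF realises_comp[OF realises_evolve
      realises_isometry[OF isometry_filter]] realises_evolve_inv] realises_diffuse]
  by (simp add: iterate_def[abs_def])

definition tensor :: "(nat \<times> bool \<Rightarrow> complex) \<Rightarrow> (nat \<times> bool \<Rightarrow> complex) \<Rightarrow> index \<Rightarrow> complex" where
  "tensor f g = (\<lambda>(p, q, k). f p * g q * of_real (a k))"

definition prepare :: "(nat \<Rightarrow> nat \<Rightarrow> complex) \<Rightarrow> (index \<Rightarrow> complex) \<Rightarrow> index \<Rightarrow> complex" where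
  "prepare U f = query_op U (swap (query_op U f))"

lemma realises_prepare: "realises 2 prepare"
  using realises_comp[OF realises_comp[OF realises_query realises_isometry[OF isometry_swap]] realises_query]
  by (simp add: prepare_def[abs_def] numeral_2_eq_2)

lemma prepare_tensor: "prepare U (tensor \<beta> \<beta>) = tensor (\<Psi> U) (\<Psi> U)"
proof -
  have *: "query_op U (tensor \<beta> g) = tensor (\<Psi> U) g" for g
  proof
    fix x :: index
    obtain p q k where x: "x = (p, q, k)" by (metis surj_pair)
    have "query_op U (tensor \<beta> g) x = P_query U (\<lambda>p. g q * of_real (a k) * \<beta> p) p"
      by (simp add: x query_op_eq tensor_def mult_ac)
    then show "query_op U (tensor \<beta> g) x = tensor (\<Psi> U) g x"
      by (simp add: P_query_scale P_query_beta x tensor_def)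
  qed
  have "swap (tensor f g) = tensor g f" for f g
    by (auto simp: swap_def tensor_def)
  then show ?thesis by (simp add: prepare_def *)
qed

lemma l2_tensor: "l2 X (tensor f g) = l2 P f * l2 P g"
proof -
  have "(l2 X (tensor f g))\<^sup>2 = (\<Sum>p\<in>P. \<Sum>q\<in>P. \<Sum>k<K. (cmod (f p))\<^sup>2 * (cmod (g q))\<^sup>2 * (a k)\<^sup>2)"
    unfolding l2_sq X_def
    by (simp add: sum.cartesian_product case_prod_unfold tensor_def norm_mult power_mult_distrib)
  also have "\<dots> = (l2 P f)\<^sup>2 * (l2 P g)\<^sup>2"
    by (simp add: sum_distrib_left[symmetric] a_unit l2_sq sum_distrib_right[symmetric])
  finally show ?thesis
    by (metis l2_nonneg mult_nonneg_nonneg power2_eq_imp_eq power_mult_distrib)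
qed

end

section \<open>Error analysis\<close>

text \<open>\<open>g\<close> is the amplitude gap after scaling by \<open>s\<close>. The bound
  \<open>g \<le> c1\<close> separates the two targets \<open>c1\<close> and \<open>- c1\<close> from
  each other.\<close>

locale search_run = search +
  fixes U :: "nat \<Rightarrow> nat \<Rightarrow> complex" and \<psi> :: "nat \<Rightarrow> real" and x1 :: nat and g \<epsilon> :: real
  assumes U: "unitary_fn N U"
    and amplitude: "\<And>x. x < N \<Longrightarrow> U x 0 = of_real (\<psi> x)" "\<And>x. x < N \<Longrightarrow> 0 \<le> \<psi> x"
    and x1: "x1 < N" "s * \<psi> x1 = c1"
    and gap: "\<And>x. x < N \<Longrightarrow> x \<noteq> x1 \<Longrightarrow> s * \<psi> x \<le> c1 - g" "g \<le> c1"
    and decay: "\<And>z. cmod z = 1 \<Longrightarrow> g \<le> cmod (1 - z) \<Longrightarrow>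
        cmod (\<Sum>k<K. of_real ((a k)\<^sup>2) * z ^ k) \<le> \<epsilon>"
    and eps: "\<epsilon> \<le> 1" and g_pos: "0 < g"
begin

definition q1 :: "nat \<times> bool" where "q1 = (x1, True)"

definition amp :: "nat \<times> bool \<Rightarrow> real" where
  "amp q = (if q \<in> P \<and> snd q then s * \<psi> (fst q) else 0)"

definition sgn1 :: "nat \<times> bool \<Rightarrow> complex" where
  "sgn1 q = (if q = q1 then - 1 else 1)"

lemma amp_q1: "amp q1 = c1"
  using x1 by (simp add: amp_def q1_def P_def)

lemma amp_nonneg: "0 \<le> amp q"
  using amplitude(2) s_range by (auto simp: amp_def P_def)

lemma amp_gap: "q \<noteq> q1 \<Longrightarrow> amp q \<le> c1 - g"
  using gap by (cases q) (auto simp: amp_def P_def q1_def)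

lemma amp_small: "\<bar>amp q\<bar> \<le> 1 / 2"
  using amp_nonneg[of q] amp_gap[of q] amp_q1 c1_range g_pos by (cases "q = q1") auto

lemma ip_ket_Psi: "ip P (ket q) (\<Psi> U) = of_real (amp q)"
  using amplitude(1) by (cases q) (auto simp: ip_ket amp_def \<Psi>_def flag_def)

lemma grover_pair_ket: "grover_pair P (\<Psi> U) (ket q) (amp q)"
  by unfold_locales (use Psi_unit[OF U] ket_unit ip_ket_Psi amp_small in auto)

text \<open>The overlap of two waves is the \<open>decay\<close> sum at the ratio of their
  eigenvalues. These have modulus 1, so the ratio is as far from 1 as they are from each other, and
  \<open>phase_separation\<close> applies.\<close>

lemma target_overlap:
  assumes "\<bar>c\<bar> \<le> 1 / 2" "\<bar>c'\<bar> \<le> 1 / 2" "g \<le> \<bar>c - c'\<bar>"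
  shows "cmod (ip {..<K} (target c) (target c')) \<le> \<epsilon>"
proof -
  define m m' where "m = - (phase c)\<^sup>2" and "m' = - (phase c')\<^sup>2"
  have m: "cmod m = 1" "cmod m' = 1"
    using assms(1,2) norm_phase_sq by (auto simp: m_def m'_def)
  have "m * (1 - cnj m * m') = m - m'"
    using m(1) by (simp add: algebra_simps) (metis complex_norm_square mult.assoc mult_1 of_real_1 power_one)
  then have "cmod (1 - cnj m * m') = cmod (m - m')"
    using m(1) by (metis mult_1 norm_mult)
  also have "\<dots> = cmod ((phase c)\<^sup>2 - (phase c')\<^sup>2)"
    unfolding m_def m'_def by (metis norm_minus_cancel minus_diff_eq minus_diff_minus)
  finally have "g \<le> cmod (1 - cnj m * m')"
    using phase_separation[OF assms(1,2)] assms(3) by linarith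
  then have "cmod (\<Sum>k<K. of_real ((a k)\<^sup>2) * (cnj m * m') ^ k) \<le> \<epsilon>"
    using m by (intro decay) (simp_all add: norm_mult)
  then show ?thesis by (simp add: target_def ip_wave m_def m'_def)
qed

text \<open>Both signs of \<open>c\<close> occur, one for each eigenpart. For \<open>q\<close> other
  than \<open>q1\<close> the modulus of \<open>c\<close> is at most \<open>c1 - g\<close>, so
  \<open>c\<close> keeps distance \<open>g\<close> from both targets.\<close>

lemma filter_wave_error:
  assumes "c = amp q \<or> c = - amp q"
  shows "cmod (filter_wave (target c) k - sgn1 q * target c k) \<le> 8 * \<epsilon> * a k"
proof -
  have c1: "\<bar>c1\<bar> \<le> 1 / 2" "\<bar>- c1\<bar> \<le> 1 / 2" using c1_range by auto
  have c: "\<bar>c\<bar> \<le> 1 / 2" using assms amp_small[of q] by auto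
  have AB: "cmod (ip {..<K} (target (- c1)) (target c1)) \<le> \<epsilon>"
    by (rule target_overlap) (use c1 gap(2) c1_range in auto)
  show ?thesis
  proof (cases "q = q1")
    case True
    then have "c = c1 \<or> c = - c1" using assms amp_q1 by auto
    then show ?thesis
      using two_reflections_near_minus_identity[OF norm_target[OF c1(1)] norm_target[OF c1(2)]
          target_unit[OF c1(1)] target_unit[OF c1(2)] AB eps, of k]
      by (auto simp: True sgn1_def filter_wave_def)
  next
    case False
    have "g \<le> \<bar>c1 - c\<bar>" "g \<le> \<bar>- c1 - c\<bar>"
      using assms amp_gap[OF False] amp_nonneg[of q] by auto
    then show ?thesis
      using two_reflections_near_identity[OF norm_target[OF c1(1)] norm_target[OF c1(2)] AB eps
          target_overlap target_overlap, of c k] c c1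
      by (simp add: False sgn1_def filter_wave_def)
  qed
qed

lemma evolve_tensor:
  "evolve U (tensor (\<Psi> U) \<chi>) (p, q, k) = \<chi> q * (eigenpart (\<Psi> U) (ket q) (amp q) p * target (amp q) k
      + eigenpart (\<Psi> U) (\<lambda>p. - ket q p) (- amp q) p * target (- amp q) k)"
proof -
  interpret grover_pair P "\<Psi> U" "ket q" "amp q" by (rule grover_pair_ket)
  have "evolve U (tensor (\<Psi> U) \<chi>) (p, q, k) =
      (grover P (\<Psi> U) (ket q) ^^ k) (\<lambda>p. (\<chi> q * of_real (a k)) * \<Psi> U p) p"
    by (simp add: evolve_def tensor_def mult_ac)
  also have "\<dots> = \<chi> q * of_real (a k) * (grover P (\<Psi> U) (ket q) ^^ k) (\<Psi> U) p"
    by (simp only: isometry_on_scale[OF isometry_on_funpow[OF isometry_grover]])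
  finally show ?thesis
    unfolding grover_funpow by (simp add: target_def wave_def algebra_simps)
qed

lemma sgn1_reflect: "(\<lambda>q. sgn1 q * \<chi> q) = reflect P (ket q1) \<chi>"
  using x1 unfolding reflect_def ip_ket by (auto simp: sgn1_def ket_def q1_def fun_eq_iff)

lemma l2_Psi: "l2 P (\<Psi> U) = 1"
proof -
  have "complex_of_real ((l2 P (\<Psi> U))\<^sup>2) = complex_of_real 1"
    using ip_self[of P "\<Psi> U"] Psi_unit[OF U] by simp
  then have "(l2 P (\<Psi> U))\<^sup>2 = 1" by (simp only: of_real_eq_iff)
  then show ?thesis using l2_nonneg[of P "\<Psi> U"] by (simp add: power2_eq_1_iff)
qed

text \<open>Each of the two eigenparts contributes 8 \<epsilon> pointwise. In the squared norm the
  first copy contributes at most 2 + 2, since \<Psi> is a unit vector and \<open>ket q\<close> has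
  norm at most 1; its root doubles 16 \<epsilon> to 32 \<epsilon>.\<close>

lemma filter_error:
  assumes "l2 P \<chi> = 1"
  shows "l2 X (\<lambda>x. filter_op (evolve U (tensor (\<Psi> U) \<chi>)) x
           - evolve U (tensor (\<Psi> U) (\<lambda>q. sgn1 q * \<chi> q)) x) \<le> 32 * \<epsilon>"
    (is "l2 X ?d \<le> _")
proof -
  have e0: "0 \<le> \<epsilon>"
  proof -
    \<comment> \<open>The point -1 has distance 2 from 1, and \<open>g \<le> c1 \<le> 1 / 2\<close>,
      so \<open>decay\<close> bounds a norm by \<epsilon> there.\<close>
    have "cmod (\<Sum>k<K. of_real ((a k)\<^sup>2) * (- 1) ^ k) \<le> \<epsilon>"
      using gap(2) c1_range by (intro decay) auto
    then show ?thesis using norm_ge_zero order_trans by blast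
  qed
  have bound: "cmod (?d (p, q, k)) \<le> 16 * \<epsilon> * (cmod (\<chi> q) * a k * (cmod (\<Psi> U p) + cmod (ket q p)))"
    for p q k
  proof -
    interpret m: grover_pair P "\<Psi> U" "\<lambda>p. - ket q p" "- amp q"
      by (rule grover_pair.grover_pair_minus[OF grover_pair_ket])
    interpret grover_pair P "\<Psi> U" "ket q" "amp q" by (rule grover_pair_ket)
    define v v' where "v = eigenpart (\<Psi> U) (ket q) (amp q)"
      and "v' = eigenpart (\<Psi> U) (\<lambda>p. - ket q p) (- amp q)"
    define A A' where "A = target (amp q)" and "A' = target (- amp q)"
    define B where "B = cmod (\<Psi> U p) + cmod (ket q p)"
    have B: "cmod (v p) \<le> B" "cmod (v' p) \<le> B"
      using norm_eigenpart[of p] m.norm_eigenpart[of p] by (simp_all add: v_def v'_def B_def)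
    have "filter_op (evolve U (tensor (\<Psi> U) \<chi>)) (p, q, k)
        = filter_wave (\<lambda>k. \<chi> q * v p * A k + \<chi> q * v' p * A' k) k"
      by (simp add: filter_op_def evolve_tensor v_def v'_def A_def A'_def algebra_simps)
    also have "\<dots> = \<chi> q * v p * filter_wave A k + \<chi> q * v' p * filter_wave A' k"
      by (simp only: isometry_on_add[OF isometry_filter_wave] isometry_on_scale[OF isometry_filter_wave])
    finally have "?d (p, q, k) = \<chi> q * (v p * (filter_wave A k - sgn1 q * A k)
        + v' p * (filter_wave A' k - sgn1 q * A' k))"
      by (simp add: evolve_tensor v_def v'_def A_def A'_def algebra_simps)
    then have "cmod (?d (p, q, k)) = cmod (\<chi> q) * cmod (v p * (filter_wave A k - sgn1 q * A k)
        + v' p * (filter_wave A' k - sgn1 q * A' k))"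
      by (simp only: norm_mult)
    also have "\<dots> \<le> cmod (\<chi> q) * (cmod (v p * (filter_wave A k - sgn1 q * A k))
        + cmod (v' p * (filter_wave A' k - sgn1 q * A' k)))"
      by (intro mult_left_mono norm_triangle_ineq) simp
    also have "\<dots> = cmod (\<chi> q) * (cmod (v p) * cmod (filter_wave A k - sgn1 q * A k)
        + cmod (v' p) * cmod (filter_wave A' k - sgn1 q * A' k))"
      by (simp only: norm_mult)
    also have "\<dots> \<le> cmod (\<chi> q) * (B * (8 * \<epsilon> * a k) + B * (8 * \<epsilon> * a k))"
      unfolding A_def A'_def
      by (intro mult_left_mono add_mono mult_mono B filter_wave_error) (auto simp: B_def)
    finally show ?thesis by (simp add: B_def algebra_simps)
  qed
  have ket_le: "(\<Sum>p\<in>P. (cmod (ket q p))\<^sup>2) \<le> 1" for q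
  proof -
    have "(\<Sum>p\<in>P. (cmod (ket q p))\<^sup>2) \<le> (\<Sum>p\<in>P. if p = q then 1 else 0)"
      by (rule sum_mono) (auto simp: ket_def)
    also have "\<dots> \<le> 1" by simp
    finally show ?thesis .
  qed
  have Psi1: "(\<Sum>p\<in>P. (cmod (\<Psi> U p))\<^sup>2) = 1"
    using l2_sq[of P "\<Psi> U"] l2_Psi by simp
  have "(l2 X ?d)\<^sup>2 \<le> (\<Sum>x\<in>X. (case x of (p, q, k) \<Rightarrow>
      (16 * \<epsilon>)\<^sup>2 * ((cmod (\<chi> q))\<^sup>2 * (a k)\<^sup>2 * (2 * (cmod (\<Psi> U p))\<^sup>2 + 2 * (cmod (ket q p))\<^sup>2))))"
    unfolding l2_sq
  proof (rule sum_mono)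
    fix x :: index
    obtain p q k where x: "x = (p, q, k)" by (metis surj_pair)
    have sq: "(\<xi> + \<eta>)\<^sup>2 \<le> 2 * \<xi>\<^sup>2 + 2 * \<eta>\<^sup>2" for \<xi> \<eta> :: real
      using sum_squares_bound[of \<xi> \<eta>] by (simp add: power2_sum)
    have "(cmod (?d x))\<^sup>2 \<le> (16 * \<epsilon> * (cmod (\<chi> q) * a k * (cmod (\<Psi> U p) + cmod (ket q p))))\<^sup>2"
      unfolding x by (intro power_mono bound) simp
    also have "\<dots> = (16 * \<epsilon>)\<^sup>2 * ((cmod (\<chi> q))\<^sup>2 * (a k)\<^sup>2 * (cmod (\<Psi> U p) + cmod (ket q p))\<^sup>2)"
      by (simp add: power_mult_distrib)
    also have "\<dots> \<le> (16 * \<epsilon>)\<^sup>2 * ((cmod (\<chi> q))\<^sup>2 * (a k)\<^sup>2 * (2 * (cmod (\<Psi> U p))\<^sup>2 + 2 * (cmod (ket q p))\<^sup>2))"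
      by (intro mult_left_mono sq) auto
    finally show "(cmod (?d x))\<^sup>2 \<le> (case x of (p, q, k) \<Rightarrow>
      (16 * \<epsilon>)\<^sup>2 * ((cmod (\<chi> q))\<^sup>2 * (a k)\<^sup>2 * (2 * (cmod (\<Psi> U p))\<^sup>2 + 2 * (cmod (ket q p))\<^sup>2)))"
      by (simp add: x)
  qed
  also have "\<dots> = (\<Sum>q\<in>P. \<Sum>k<K. \<Sum>p\<in>P. (16 * \<epsilon>)\<^sup>2 * ((cmod (\<chi> q))\<^sup>2 * (a k)\<^sup>2
      * (2 * (cmod (\<Psi> U p))\<^sup>2 + 2 * (cmod (ket q p))\<^sup>2)))"
    unfolding sum_X by simp
  also have "\<dots> = (\<Sum>q\<in>P. \<Sum>k<K. (16 * \<epsilon>)\<^sup>2 * ((cmod (\<chi> q))\<^sup>2 * (a k)\<^sup>2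
      * (2 + 2 * (\<Sum>p\<in>P. (cmod (ket q p))\<^sup>2))))"
    by (simp only: sum_distrib_left[symmetric] sum.distrib Psi1) simp
  also have "\<dots> \<le> (\<Sum>q\<in>P. \<Sum>k<K. (16 * \<epsilon>)\<^sup>2 * ((cmod (\<chi> q))\<^sup>2 * (a k)\<^sup>2 * 4))"
    by (intro sum_mono mult_left_mono) (use ket_le in auto)
  also have "\<dots> = (32 * \<epsilon>)\<^sup>2 * ((\<Sum>q\<in>P. (cmod (\<chi> q))\<^sup>2) * (\<Sum>k<K. (a k)\<^sup>2))"
    by (simp add: sum_product sum_distrib_left power_mult_distrib mult_ac)
  also have "\<dots> = (32 * \<epsilon>)\<^sup>2"
    using assms a_unit by (simp add: l2_sq[symmetric])
  finally show ?thesis by (rule power2_le_imp_le) (use e0 in simp)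
qed

lemma isometry_evolve_inv: "isometry_on X (evolve_inv U)"
  unfolding X_def evolve_inv_def
  by (rule isometry_on_slice1)
     (auto intro!: isometry_on_funpow grover_pair.isometry_grover_inv[OF grover_pair_ket])

lemma isometry_evolve: "isometry_on X (evolve U)"
  unfolding X_def evolve_def
  by (rule isometry_on_slice1)
     (auto intro!: isometry_on_funpow grover_pair.isometry_grover[OF grover_pair_ket])

lemma isometry_diffuse: "isometry_on X (diffuse U)"
  unfolding X_def diffuse_def
  by (intro isometry_on_slice1 isometry_on_slice2 isometry_on_reflect) (simp add: Psi_unit[OF U])

lemma isometry_iterate: "isometry_on X (iterate U)"
  unfolding iterate_def[abs_def]
  by (rule isometry_on_comp[OF isometry_diffuse isometry_on_comp[OF isometry_evolve_inv
        isometry_on_comp[OF isometry_filter isometry_evolve]]])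

lemma evolve_inv_evolve: "evolve_inv U (evolve U f) = f"
  by (auto simp: evolve_inv_def evolve_def fun_eq_iff
      grover_pair.grover_inv_funpow[OF grover_pair_ket])

text \<open>Undoing the evolution and diffusing preserve norms, so the filter error passes through
  unchanged. With the exact sign flip in place of the filter, the round is exactly a Grover step on
  the second copy.\<close>

lemma iterate_error:
  assumes "l2 P \<chi> = 1"
  shows "l2 X (\<lambda>x. iterate U (tensor (\<Psi> U) \<chi>) x
           - tensor (\<Psi> U) (grover P (\<Psi> U) (ket q1) \<chi>) x) \<le> 32 * \<epsilon>"
proof -
  let ?f = "filter_op (evolve U (tensor (\<Psi> U) \<chi>))"
  let ?h = "evolve U (tensor (\<Psi> U) (\<lambda>q. sgn1 q * \<chi> q))"
  have "diffuse U (tensor (\<Psi> U) \<chi>') = tensor (\<Psi> U) (reflect P (\<Psi> U) \<chi>')" for \<chi>'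
  proof
    fix x :: index
    obtain p q k where x: "x = (p, q, k)" by (metis surj_pair)
    have "diffuse U (tensor (\<Psi> U) \<chi>') x = reflect P (\<Psi> U) (\<lambda>q. (\<Psi> U p * of_real (a k)) * \<chi>' q) q"
      by (simp add: x diffuse_def tensor_def mult_ac)
    then show "diffuse U (tensor (\<Psi> U) \<chi>') x = tensor (\<Psi> U) (reflect P (\<Psi> U) \<chi>') x"
      by (simp add: isometry_on_scale[OF isometry_on_reflect[of P "\<Psi> U"]] Psi_unit[OF U] x tensor_def)
  qed
  then have h: "diffuse U (evolve_inv U ?h) = tensor (\<Psi> U) (grover P (\<Psi> U) (ket q1) \<chi>)"
    by (simp add: evolve_inv_evolve grover_def sgn1_reflect)
  have iso: "isometry_on X (\<lambda>f. diffuse U (evolve_inv U f))"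
    by (rule isometry_on_comp[OF isometry_diffuse isometry_evolve_inv])
  show ?thesis
    using filter_error[OF assms] isometry_on_l2[OF iso, of "\<lambda>x. ?f x - ?h x"]
    unfolding isometry_on_diff[OF iso, of ?f ?h] h iterate_def by simp
qed

text \<open>Hybrid argument: an isometry does not amplify earlier errors, and each round, compared
  from the ideal product state, adds at most 32 \<epsilon>.\<close>

lemma funpow_iterate_error:
  "l2 X (\<lambda>x. (iterate U ^^ t) (tensor (\<Psi> U) (\<Psi> U)) x
     - tensor (\<Psi> U) ((grover P (\<Psi> U) (ket q1) ^^ t) (\<Psi> U)) x) \<le> real t * (32 * \<epsilon>)"
proof (induction t)
  case 0
  show ?case by (simp add: l2_def L2_set_def)
next
  case (Suc t)
  interpret grover_pair P "\<Psi> U" "ket q1" "amp q1" by (rule grover_pair_ket)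
  let ?f = "(iterate U ^^ t) (tensor (\<Psi> U) (\<Psi> U))"
  let ?\<chi> = "(grover P (\<Psi> U) (ket q1) ^^ t) (\<Psi> U)"
  let ?h = "tensor (\<Psi> U) ?\<chi>"
  let ?h' = "tensor (\<Psi> U) (grover P (\<Psi> U) (ket q1) ?\<chi>)"
  have "l2 P ?\<chi> = 1"
    using isometry_on_l2[OF isometry_on_funpow[OF isometry_grover]] l2_Psi by simp
  note e = iterate_error[OF this]
  have "l2 X (\<lambda>x. iterate U ?f x - iterate U ?h x) = l2 X (\<lambda>x. ?f x - ?h x)"
    using isometry_on_l2[OF isometry_iterate, of "\<lambda>x. ?f x - ?h x"]
    by (simp add: isometry_on_diff[OF isometry_iterate])
  then have "l2 X (\<lambda>x. (iterate U ?f x - iterate U ?h x) + (iterate U ?h x - ?h' x)) \<le> real t * (32 * \<epsilon>) + 32 * \<epsilon>"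
    using l2_triangle[of X "\<lambda>x. iterate U ?f x - iterate U ?h x" "\<lambda>x. iterate U ?h x - ?h' x"] Suc e
    by linarith
  then show ?case by (simp add: algebra_simps)
qed

text \<open>The ideal final state is supported where the second copy shows \<open>x1\<close>, so the
  triangle inequality leaves norm 1 - e there for total error e; squaring gives at least 1 -
  2e.\<close>

lemma final_amplitude:
  assumes "c1 = sin \<theta>" "cos \<theta> > 0" "real (2 * T + 1) * \<theta> = pi / 2" "real T * (32 * \<epsilon>) \<le> 1"
  shows "(\<Sum>x\<in>{x \<in> X. fst (fst (snd x)) = x1}. (cmod ((iterate U ^^ T) (tensor (\<Psi> U) (\<Psi> U)) x))\<^sup>2)
     \<ge> 1 - 2 * (real T * (32 * \<epsilon>))"
proof -
  interpret grover_pair P "\<Psi> U" "ket q1" "amp q1" by (rule grover_pair_ket)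
  define Y where "Y = {x \<in> X. fst (fst (snd x)) = x1}"
  define f where "f = (iterate U ^^ T) (tensor (\<Psi> U) (\<Psi> U))"
  define h where "h = tensor (\<Psi> U) ((grover P (\<Psi> U) (ket q1) ^^ T) (\<Psi> U))"
  have Y: "Y \<subseteq> X" by (auto simp: Y_def)
  have "l2 P ((grover P (\<Psi> U) (ket q1) ^^ T) (\<Psi> U)) = 1"
    using isometry_on_l2[OF isometry_on_funpow[OF isometry_grover]] l2_Psi by simp
  then have h1: "l2 X h = 1" by (simp add: h_def l2_tensor l2_Psi)
  have h: "h = tensor (\<Psi> U) (\<lambda>p. (- 1) ^ T * ket q1 p)"
    unfolding h_def using grover_funpow_quarter_turn[OF _ assms(2,3)] assms(1) amp_q1 by simp
  have "(l2 Y h)\<^sup>2 = (l2 X h)\<^sup>2"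
    unfolding l2_sq using Y by (intro sum.mono_neutral_left)
      (auto simp: h tensor_def ket_def Y_def q1_def split: if_splits)
  then have hY: "l2 Y h = 1" using h1 l2_nonneg[of Y h] by (simp add: power2_eq_1_iff)
  have "l2 Y h \<le> l2 Y f + l2 Y (\<lambda>x. h x - f x)"
    using l2_triangle[of Y f "\<lambda>x. h x - f x"] by simp
  moreover have "l2 Y (\<lambda>x. h x - f x) = l2 Y (\<lambda>x. f x - h x)"
    by (simp add: l2_def norm_minus_commute)
  moreover have "l2 Y (\<lambda>x. f x - h x) \<le> real T * (32 * \<epsilon>)"
    using l2_subset[OF finite_X Y] funpow_iterate_error[of T] unfolding f_def h_def by (rule order_trans)
  ultimately have "1 - real T * (32 * \<epsilon>) \<le> l2 Y f" using hY by linarith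
  then have "(1 - real T * (32 * \<epsilon>))\<^sup>2 \<le> (l2 Y f)\<^sup>2" using assms(4) by (intro power_mono) auto
  moreover have "1 - 2 * e \<le> (1 - e)\<^sup>2" for e :: real
    by (simp add: power2_diff)
  ultimately have "1 - 2 * (real T * (32 * \<epsilon>)) \<le> (l2 Y f)\<^sup>2" by (metis order_trans)
  then show ?thesis by (simp add: l2_sq Y_def f_def)
qed

end

section \<open>Query complexity\<close>

text \<open>The Householder reflection along the normalised difference swaps two orthogonal unit
  vectors; \<open>w 0 = 0\<close> provides the orthogonality.\<close>

lemma unitary_sending_basis_vector:
  fixes w :: "nat \<Rightarrow> complex"
  assumes "d > 0" "w 0 = 0" "\<And>i. i \<ge> d \<Longrightarrow> w i = 0" "ip {..<d} w w = 1"
  obtains G where "unitary_fn d G" "apply_fn d G (\<lambda>k. if k = 0 then 1 else 0) = w"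
proof -
  define e where "e j = (\<lambda>i. if i = j then 1 else 0 :: complex)" for j :: nat
  define c where "c = complex_of_real (1 / sqrt 2)"
  define u where "u = (\<lambda>i. c * (e 0 i - w i))"
  define G where "G i j = reflect {..<d} u (e j) i" for i j
  have cc: "cnj c * c = 1 / 2" "2 * (c * c) = 1"
    unfolding c_def by (simp_all flip: of_real_mult)
  have ip_e: "ip {..<d} f (e j) = cnj (f j)" if "j < d" for f j
  proof -
    have "ip {..<d} f (e j) = (\<Sum>i<d. if i = j then cnj (f j) else 0)"
      unfolding ip_def by (rule sum.cong) (auto simp: e_def)
    then show ?thesis using that by simp
  qed
  have "ip {..<d} (e 0) w = 0"
    using ip_e[OF assms(1), of w] assms(2) by (subst ip_commute) simp
  then have "ip {..<d} u u = 1"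
    unfolding u_def ip_linear using ip_e[OF assms(1)] assms(2,4) cc(1)
    by (simp add: e_def algebra_simps)
  then have iso: "isometry_on {..<d} (reflect {..<d} u)"
    by (intro isometry_on_reflect) simp
  have "unitary_fn d G"
    unfolding unitary_fn_def
  proof (intro allI impI)
    fix i j assume "i < d" "j < d"
    then show "(\<Sum>k<d. cnj (G k i) * G k j) = (if i = j then 1 else 0)"
      using isometry_on_ip[OF iso, of "e i" "e j"] ip_e[of j "e i"]
      by (simp add: ip_def G_def) (simp add: e_def)
  qed
  moreover have "apply_fn d G (\<lambda>k. if k = 0 then 1 else 0) = w"
  proof
    fix i
    show "apply_fn d G (\<lambda>k. if k = 0 then 1 else 0) i = w i"
    proof (cases "i < d")
      case True
      have "apply_fn d G (\<lambda>k. if k = 0 then 1 else 0) i = (\<Sum>j<d. if j = 0 then G i 0 else 0)"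
        using True by (simp add: apply_fn_def if_distrib cong: if_cong)
      also have "\<dots> = G i 0" using assms(1) by simp
      also have "\<dots> = e 0 i - 2 * (c * c) * (e 0 i - w i)"
        unfolding G_def reflect_def ip_e[OF assms(1)] using assms(2)
        by (simp add: u_def e_def c_def)
      also have "\<dots> = w i" unfolding cc(2) by simp
      finally show ?thesis .
    qed (simp add: apply_fn_def assms(3))
  qed
  ultimately show ?thesis by (rule that)
qed

context search
begin

lemma search_algorithm:
  obtains A where "valid_alg N A" "num_queries A = 2 + T * (4 * K + 2)"
    and "\<forall>U x. unitary_fn N U \<longrightarrow> success_prob N U A x =
      (\<Sum>i\<in>{i \<in> X. fst (fst (snd i)) = x}. (cmod ((iterate U ^^ T) (tensor (\<Psi> U) (\<Psi> U)) i))\<^sup>2)"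
proof -
  let ?w = "emb (tensor \<beta> \<beta>)"
  have "ip {..<N * M} ?w ?w = (\<Sum>i<N * M. if i \<in> enc ` X then cnj (?w i) * ?w i else 0)"
    unfolding ip_def by (rule sum.cong) (auto simp: emb_def)
  also have "\<dots> = ip X (tensor \<beta> \<beta>) (tensor \<beta> \<beta>)"
    unfolding sum_enc ip_def by (rule sum.cong) auto
  also have "\<dots> = 1"
  proof -
    have "of_real ((l2 P \<beta>)\<^sup>2) = (1 :: complex)" using ip_self[of P \<beta>] beta_unit by simp
    then have "(l2 P \<beta>)\<^sup>2 = 1" by (simp only: of_real_eq_1_iff)
    then show ?thesis
      unfolding ip_self l2_tensor power_mult_distrib by simp
  qed
  finally have w1: "ip {..<N * M} ?w ?w = 1" .
  \<comment> \<open>Index 0 has the control bit clear and so is not an encoded position; hence the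
    start state is orthogonal to the vector to be prepared.\<close>
  have w0: "?w 0 = 0" by (simp add: emb_def enc_image)
  have w_out: "?w i = 0" if "i \<ge> N * M" for i
    using that by (simp add: emb_def enc_image)
  have NM: "N * M > 0" by (simp add: M_eq)
  obtain G where G: "unitary_fn (N * M) G" "apply_fn (N * M) G (\<lambda>k. if k = 0 then 1 else 0) = ?w"
    by (rule unitary_sending_basis_vector[OF NM w0 w_out w1])
  obtain ss where ss: "\<And>G. Gate G \<in> set ss \<Longrightarrow> unitary_fn (N * M) G"
      "length (filter is_query ss) = 2 + T * (4 * K + 2)"
      "\<And>U f. unitary_fn N U \<Longrightarrow> fold (step_apply N M U) ss (emb f) = emb ((iterate U ^^ T) (prepare U f))"
    using realises_comp[OF realises_prepare realises_funpow[OF realises_iterate, of T]]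
    unfolding realises_def by blast
  \<comment> \<open>The output is the basis state of the second copy. \<open>dec\<close> is
    arbitrary at positions that are not encoded, but the final state vanishes there.\<close>
  define A where "A = \<lparr>extra_qubits = n + l + 3, steps = Gate G # ss,
     out_map = (\<lambda>i. fst (fst (snd (dec i))))\<rparr>"
  have dim: "alg_dim N A = N * M" by (simp add: alg_dim_def A_def M_def)
  show ?thesis
  proof (rule that)
    show "valid_alg N A"
      unfolding valid_alg_def dim using ss(1) G(1) by (auto simp: A_def)
    show "num_queries A = 2 + T * (4 * K + 2)"
      using ss(2) by (simp add: num_queries_def A_def)
  next
    show "\<forall>U x. unitary_fn N U \<longrightarrow> success_prob N U A x =
      (\<Sum>i\<in>{i \<in> X. fst (fst (snd i)) = x}. (cmod ((iterate U ^^ T) (tensor (\<Psi> U) (\<Psi> U)) i))\<^sup>2)"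
    proof (intro allI impI)
      fix U x assume U: "unitary_fn N U"
      let ?f = "(iterate U ^^ T) (tensor (\<Psi> U) (\<Psi> U))"
      have "final_state N U A = emb ?f"
        using G(2) ss(3)[OF U] by (simp add: final_state_def A_def prepare_tensor flip: M_def)
      then have "success_prob N U A x = (\<Sum>i<N * M. if i \<in> enc ` X then
          (if fst (fst (snd (dec i))) = x then (cmod (?f (dec i)))\<^sup>2 else 0) else 0)"
        unfolding success_prob_def dim by (intro sum.cong) (auto simp: A_def emb_def)
      also have "\<dots> = (\<Sum>i\<in>X. if fst (fst (snd i)) = x then (cmod (?f i))\<^sup>2 else 0)"
        unfolding sum_enc by (rule sum.cong) auto
      also have "\<dots> = (\<Sum>i\<in>{i \<in> X. fst (fst (snd i)) = x}. (cmod (?f i))\<^sup>2)"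
        by (simp add: sum.inter_filter)
      finally show "success_prob N U A x = \<dots>" .
    qed
  qed
qed

end

section \<open>Choice of the parameters and query count\<close>

lemma half_le_sin:
  assumes "0 \<le> x" "x \<le> pi / 3" shows "x / 2 \<le> sin x"
proof -
  have "sin 0 - 0 / 2 \<le> sin x - x / 2"
  proof (rule DERIV_nonneg_imp_nondecreasing[OF assms(1)])
    fix y assume y: "0 \<le> y" "y \<le> x"
    have "cos (pi / 3) \<le> cos y"
      using y assms by (intro cos_monotone_0_pi_le) auto
    then have "0 \<le> cos y - 1 / 2" by (simp add: cos_60)
    moreover have "((\<lambda>y. sin y - y / 2) has_real_derivative cos y - 1 / 2) (at y)"
      by (auto intro!: derivative_eq_intros)
    ultimately show "\<exists>D. ((\<lambda>y. sin y - y / 2) has_real_derivative D) (at y) \<and> 0 \<le> D" by blast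
  qed
  then show ?thesis by simp
qed

lemma half_le_ln2: "1 / 2 \<le> ln (2::real)"
  using ln_le_minus_one[of "1 / 2 :: real"] by (simp add: ln_div)

lemma search_algorithm_exists:
  fixes \<psi>\<^sub>1 \<Delta> \<delta> :: real
  assumes "0 < \<Delta>" "\<Delta> \<le> \<psi>\<^sub>1" "\<psi>\<^sub>1 \<le> 1" "0 < \<delta>" "\<delta> < 1"
  obtains A where "valid_alg (2 ^ n) A"
    and "real (num_queries A) \<le> 24000 / (\<psi>\<^sub>1 * \<Delta>) *
       (ln (2 + real (2 ^ n)) + ln (2 + 1 / \<psi>\<^sub>1) + ln (2 + 1 / \<Delta>) + ln (2 + 1 / \<delta>))"
    and "\<forall>U \<psi> x\<^sub>1. unitary_fn (2 ^ n) U \<longrightarrow> x\<^sub>1 < 2 ^ n \<longrightarrow> \<psi> x\<^sub>1 = \<psi>\<^sub>1 \<longrightarrow>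
       (\<forall>x<2 ^ n. U x 0 = of_real (\<psi> x) \<and> 0 \<le> \<psi> x) \<longrightarrow>
       (\<forall>x<2 ^ n. x \<noteq> x\<^sub>1 \<longrightarrow> \<psi> x \<le> \<psi>\<^sub>1 - \<Delta>) \<longrightarrow>
       success_prob (2 ^ n) U A x\<^sub>1 \<ge> 1 - \<delta>"
proof -
  have psi: "0 < \<psi>\<^sub>1" using assms by linarith
  define T where "T = nat \<lceil>1 / \<psi>\<^sub>1\<rceil>"
  have T_lower: "1 / \<psi>\<^sub>1 \<le> real T" unfolding T_def by (rule real_nat_ceiling_ge)
  have "1 \<le> 1 / \<psi>\<^sub>1" using psi assms(3) by simp
  then have T1: "1 \<le> T" using T_lower by linarith
  have "real T \<le> 1 / \<psi>\<^sub>1 + 1" unfolding T_def using psi by (simp add: of_nat_ceiling less_imp_le)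
  then have T_upper: "real T \<le> 2 / \<psi>\<^sub>1" using \<open>1 \<le> 1 / \<psi>\<^sub>1\<close> by simp

  \<comment> \<open>The angle solves (2T+1) \<theta> = pi/2.
    \<open>T \<ge> 1 / \<psi>\<^sub>1\<close> yields \<open>\<theta> \<le> \<psi>\<^sub>1\<close>,
    hence \<open>s \<le> 1\<close> below; \<open>T \<ge> 1\<close> yields
    \<open>\<theta> \<le> pi / 6\<close>, hence \<open>c1 \<le> 1 / 2\<close>.\<close>
  define \<theta> where "\<theta> = pi / (2 * (2 * real T + 1))"
  have \<theta>0: "0 < \<theta>" by (simp add: \<theta>_def)
  have \<theta>6: "\<theta> \<le> pi / 6"
    unfolding \<theta>_def using T1 by (intro divide_left_mono) auto
  have "\<theta> \<le> 4 / (2 * (2 * real T))"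
    unfolding \<theta>_def using T1 pi_less_4 by (intro frac_le) auto
  also have "\<dots> = 1 / real T" by simp
  also have "\<dots> \<le> \<psi>\<^sub>1" using T_lower psi T1 by (simp add: field_simps)
  finally have \<theta>psi: "\<theta> \<le> \<psi>\<^sub>1" .
  define c1 where "c1 = sin \<theta>"
  have "\<theta> < pi" using \<theta>6 pi_gt_zero by linarith
  then have c1_pos: "0 < c1" unfolding c1_def using \<theta>0 by (intro sin_gt_zero)
  have "sin \<theta> \<le> sin (pi / 6)" using \<theta>0 \<theta>6 pi_gt_zero by (intro sin_monotone_2pi_le) linarith+
  then have c1_half: "c1 \<le> 1 / 2" by (simp add: c1_def sin_30)
  have c1_psi: "c1 \<le> \<psi>\<^sub>1" unfolding c1_def using sin_x_le_x[of \<theta>] \<theta>0 \<theta>psi by linarith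
  \<comment> \<open>From \<open>sin \<theta> \<ge> \<theta> / 2\<close>, pi at least 2 and
    \<open>2T + 1 \<le> 5 / \<psi>\<^sub>1\<close>. It gives \<open>s \<ge> 1 / 10\<close>, so the
    scaling shrinks the gap by at most a factor of ten.\<close>
  have "\<psi>\<^sub>1 / 10 \<le> c1"
  proof -
    have "2 * real T + 1 \<le> 5 / \<psi>\<^sub>1" using T_upper \<open>1 \<le> 1 / \<psi>\<^sub>1\<close> by simp
    then have "\<psi>\<^sub>1 * (2 * real T + 1) \<le> 5" using psi by (simp add: field_simps)
    then have "\<psi>\<^sub>1 / 10 \<le> 2 / (4 * (2 * real T + 1))" by (simp add: field_simps)
    also have "\<dots> \<le> pi / (4 * (2 * real T + 1))" using pi_ge_two by (intro divide_right_mono) auto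
    also have "\<dots> = \<theta> / 2" by (simp add: \<theta>_def)
    also have "\<dots> \<le> c1" unfolding c1_def using \<theta>0 \<theta>6 pi_gt_zero by (intro half_le_sin) linarith+
    finally show ?thesis .
  qed
  define s where "s = c1 / \<psi>\<^sub>1"
  have s: "1 / 10 \<le> s" "s \<le> 1" "s * \<psi>\<^sub>1 = c1"
    using psi c1_psi \<open>\<psi>\<^sub>1 / 10 \<le> c1\<close> by (simp_all add: s_def field_simps)
  define g where "g = s * \<Delta>"
  have g_pos: "0 < g" using s assms(1) by (simp add: g_def)
  have "s * \<Delta> \<le> s * \<psi>\<^sub>1" using s(1) assms(2) by (intro mult_left_mono) auto
  then have g_c1: "g \<le> c1" by (simp add: g_def s(3))

  \<comment> \<open>\<open>norm_geometric_mean_le_half\<close> asks for \<open>L\<close> times the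
    distance to be at least 4, and the relevant distances are at least \<open>g\<close>.\<close>
  define L where "L = nat \<lceil>4 / g\<rceil>"
  have L_lower: "4 / g \<le> real L" unfolding L_def by (rule real_nat_ceiling_ge)
  then have "0 < real L" using g_pos by (smt (verit) divide_pos_pos)
  then have L1: "1 \<le> L" by simp
  have L_upper: "real L \<le> 41 / \<Delta>"
  proof -
    have "real L \<le> 4 / g + 1" unfolding L_def using g_pos by (simp add: of_nat_ceiling less_imp_le)
    also have "4 / g \<le> 4 / (1 / 10 * \<Delta>)"
      unfolding g_def using s(1) assms(1) by (intro divide_left_mono mult_right_mono mult_pos_pos) auto
    also have "\<dots> + 1 \<le> 41 / \<Delta>" using assms(1-3) by (simp add: field_simps)
    finally show ?thesis by simp
  qed
  \<comment> \<open>Then \<open>T\<close> rounds of error 32 * 2^-r add up to at most \<delta>/2,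
    and \<open>final_amplitude\<close> doubles this to \<delta>.\<close>
  define r where "r = nat \<lceil>log 2 (64 * real T / \<delta>)\<rceil>"
  have T64: "64 \<le> 64 * real T / \<delta>"
    using T1 assms(4,5) by (simp add: field_simps)
  have r_lower: "log 2 (64 * real T / \<delta>) \<le> real r" unfolding r_def by (rule real_nat_ceiling_ge)
  have log1: "1 \<le> log 2 (64 * real T / \<delta>)" using T64 by (simp add: le_log_iff)
  then have r1: "1 \<le> r" using r_lower by linarith
  have half_power: "(1 / 2) ^ r \<le> \<delta> / (64 * real T)"
  proof -
    have "64 * real T / \<delta> = 2 powr log 2 (64 * real T / \<delta>)" using T64 by (intro powr_log_cancel[symmetric]) linarith+
    also have "\<dots> \<le> 2 powr real r" using r_lower by simp
    also have "\<dots> = 2 ^ r" by (simp add: powr_realpow)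
    finally show ?thesis using assms(4) T1 by (simp add: field_simps)
  qed
  \<comment> \<open>\<open>K = 2 ^ Suc l\<close> becomes the least power of two above
    \<open>r * L\<close>, hence at most \<open>2 * r * L\<close>.\<close>
  obtain l where l: "2 ^ l \<le> r * L" "r * L < 2 ^ Suc l"
    using ex_power_ivl1[of 2 "r * L"] r1 L1 by auto
  obtain p :: "nat \<Rightarrow> real" where p: "\<And>k. p k \<ge> 0"
    "\<And>z::complex. (\<Sum>k<2 ^ Suc l. of_real (p k) * z ^ k) = ((\<Sum>j<L. z ^ j) / of_nat L) ^ r"
    using fejer_weights[OF L1 l(2)] by blast
  define a where "a k = sqrt (p k)" for k
  have a2: "(a k)\<^sup>2 = p k" for k using p(1) by (simp add: a_def)

  interpret workspace n "Suc l" .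
  have K: "K = 2 ^ Suc l" by (simp add: K_def)
  have N: "N = 2 ^ n" by (simp add: N_def)
  interpret search n "Suc l" s c1 a
  proof
    show "0 \<le> s" "s \<le> 1" "0 < c1" "c1 \<le> 1 / 2" using s c1_pos c1_half by auto
    show "0 \<le> a k" for k using p(1) by (simp add: a_def)
    \<comment> \<open>Normalisation is the generating function at \<open>z = 1\<close>.\<close>
    have "complex_of_real (\<Sum>k<K. p k) = 1" using p(2)[of 1] L1 by (simp add: K)
    then show "(\<Sum>k<K. (a k)\<^sup>2) = 1" unfolding a2 by (simp only: of_real_eq_1_iff)
  qed
  obtain A where A: "valid_alg N A" "num_queries A = 2 + T * (4 * K + 2)"
    "\<forall>U x. unitary_fn N U \<longrightarrow> success_prob N U A x =
      (\<Sum>i\<in>{i \<in> X. fst (fst (snd i)) = x}. (cmod ((iterate U ^^ T) (tensor (\<Psi> U) (\<Psi> U)) i))\<^sup>2)"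
    by (rule search_algorithm[of T])
  show ?thesis
  proof (rule that)
    show "valid_alg (2 ^ n) A" using A(1) by (simp add: N)
    show "real (num_queries A) \<le> 24000 / (\<psi>\<^sub>1 * \<Delta>) *
       (ln (2 + real (2 ^ n)) + ln (2 + 1 / \<psi>\<^sub>1) + ln (2 + 1 / \<Delta>) + ln (2 + 1 / \<delta>))"
      (is "_ \<le> _ * ?S")
    proof -
      have "2 + T * (4 * K + 2) \<le> 8 * (T * K)"
      proof -
        have "2 * 1 \<le> 2 * T" using T1 by (intro mult_le_mono) auto
        moreover have "T * 1 \<le> T * K" by (intro mult_le_mono) (use K_pos in linarith)+
        moreover have "T * (4 * K + 2) = 4 * (T * K) + 2 * T" by (simp add: algebra_simps)
        ultimately show ?thesis by linarith
      qed
      also have "\<dots> \<le> 8 * (T * (2 * (r * L)))"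
        using l(1) by (intro mult_le_mono) (auto simp: K)
      finally have "real (num_queries A) \<le> real (8 * (T * (2 * (r * L))))"
        unfolding A(2) by (rule of_nat_mono)
      also have "\<dots> = 16 * real r * (real T * real L)" by simp
      also have "\<dots> \<le> 16 * real r * (2 / \<psi>\<^sub>1 * (41 / \<Delta>))"
        using T_upper L_upper psi by (intro mult_left_mono mult_mono) auto
      also have "\<dots> = 1312 / (\<psi>\<^sub>1 * \<Delta>) * real r" by simp
      also have "\<dots> \<le> 1312 / (\<psi>\<^sub>1 * \<Delta>) * (18 * ?S)"
      proof (rule mult_left_mono)
        \<comment> \<open>Inserting \<open>T \<le> 2 / \<psi>\<^sub>1\<close> turns 64 into 2^7, and
          rounding \<open>r\<close> up adds an eighth \<open>ln 2\<close>. The total is at most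
          \<open>9 * ?S\<close>; dividing by \<open>ln 2 \<ge> 1 / 2\<close> gives the factor 18,
          and 1312 * 18 = 23616.\<close>
        have "real r \<le> log 2 (64 * real T / \<delta>) + 1"
          unfolding r_def using log1 by (simp add: of_nat_ceiling)
        then have "real r * ln 2 \<le> ln (64 * real T / \<delta>) + ln 2"
          by (simp add: log_def field_simps)
        also have "\<dots> \<le> ln (64 * (2 / \<psi>\<^sub>1) / \<delta>) + ln 2"
        proof -
          have "64 * real T / \<delta> \<le> 64 * (2 / \<psi>\<^sub>1) / \<delta>"
            using T_upper assms(4) by (intro divide_right_mono mult_left_mono) auto
          moreover have "0 < 64 * real T / \<delta>" using T64 by linarith
          ultimately show ?thesis by (simp only: add_le_cancel_right ln_mono)
        qed
        also have "64 * (2 / \<psi>\<^sub>1) / \<delta> = 2 ^ 7 * (1 / \<psi>\<^sub>1) * (1 / \<delta>)" by simp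
        also have "ln \<dots> = 7 * ln 2 + ln (1 / \<psi>\<^sub>1) + ln (1 / \<delta>)"
          using psi assms(4) by (simp only: ln_mult ln_realpow)  (simp add: ln_mult ln_realpow ln_div)
        finally have "real r * ln 2 \<le> 8 * ln 2 + ln (1 / \<psi>\<^sub>1) + ln (1 / \<delta>)" by simp
        moreover have "ln 2 \<le> ln (2 + real (2 ^ n))" by (intro ln_mono) auto
        moreover have "ln (1 / \<psi>\<^sub>1) \<le> ln (2 + 1 / \<psi>\<^sub>1)" "ln (1 / \<delta>) \<le> ln (2 + 1 / \<delta>)"
          using psi assms(4) by (auto intro!: ln_mono add_pos_pos)
        moreover have "0 \<le> ln (2 + 1 / \<psi>\<^sub>1)" "0 \<le> ln (2 + 1 / \<delta>)" "0 \<le> ln (2 + 1 / \<Delta>)"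
          using psi assms(1,4) by (auto intro!: ln_ge_zero)
        ultimately have "real r * ln 2 \<le> 9 * ?S"
          using half_le_ln2 unfolding distrib_left by linarith
        moreover have "real r * (1 / 2) \<le> real r * ln 2" using half_le_ln2 by (intro mult_left_mono) auto
        ultimately show "real r \<le> 18 * ?S" unfolding distrib_left by linarith
        show "0 \<le> 1312 / (\<psi>\<^sub>1 * \<Delta>)" using psi assms(1) by simp
      qed
      also have "\<dots> = 23616 / (\<psi>\<^sub>1 * \<Delta>) * ?S" by simp
      also have "\<dots> \<le> 24000 / (\<psi>\<^sub>1 * \<Delta>) * ?S"
        using psi assms(1,4) by (intro mult_right_mono divide_right_mono add_nonneg_nonneg ln_ge_zero) auto
      finally show ?thesis .
    qed
  next
    show "\<forall>U \<psi> x\<^sub>1. unitary_fn (2 ^ n) U \<longrightarrow> x\<^sub>1 < 2 ^ n \<longrightarrow> \<psi> x\<^sub>1 = \<psi>\<^sub>1 \<longrightarrow>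
       (\<forall>x<2 ^ n. U x 0 = of_real (\<psi> x) \<and> 0 \<le> \<psi> x) \<longrightarrow>
       (\<forall>x<2 ^ n. x \<noteq> x\<^sub>1 \<longrightarrow> \<psi> x \<le> \<psi>\<^sub>1 - \<Delta>) \<longrightarrow>
       success_prob (2 ^ n) U A x\<^sub>1 \<ge> 1 - \<delta>"
    proof (intro allI impI)
      fix U \<psi> x\<^sub>1
      assume U: "unitary_fn (2 ^ n) U" and x1: "x\<^sub>1 < 2 ^ n" "\<psi> x\<^sub>1 = \<psi>\<^sub>1"
        and amplitude: "\<forall>x<2 ^ n. U x 0 = complex_of_real (\<psi> x) \<and> 0 \<le> \<psi> x"
        and gap: "\<forall>x<2 ^ n. x \<noteq> x\<^sub>1 \<longrightarrow> \<psi> x \<le> \<psi>\<^sub>1 - \<Delta>"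
      interpret search_run n "Suc l" s c1 a U \<psi> x\<^sub>1 g "(1 / 2) ^ r"
      proof
        show "unitary_fn N U" using U by (simp add: N)
        show "x\<^sub>1 < N" "s * \<psi> x\<^sub>1 = c1" using x1 s(3) by (simp_all add: N)
        show "U x 0 = of_real (\<psi> x)" "0 \<le> \<psi> x" if "x < N" for x
          using amplitude that by (simp_all add: N)
        show "s * \<psi> x \<le> c1 - g" if "x < N" "x \<noteq> x\<^sub>1" for x
        proof -
          have "s * \<psi> x \<le> s * (\<psi>\<^sub>1 - \<Delta>)" using that gap s(1) by (intro mult_left_mono) (auto simp: N)
          then show ?thesis by (simp add: algebra_simps g_def s(3)[symmetric])
        qed
        show "g \<le> c1" "0 < g" "(1 / 2 :: real) ^ r \<le> 1" using g_c1 g_pos by (simp_all add: power_le_one)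
        show "cmod (\<Sum>k<K. of_real ((a k)\<^sup>2) * z ^ k) \<le> (1 / 2) ^ r" if "cmod z = 1" "g \<le> cmod (1 - z)" for z
        proof -
          have "4 = 4 / g * g" using g_pos by simp
          also have "\<dots> \<le> real L * cmod (1 - z)" using L_lower that(2) g_pos by (intro mult_mono) auto
          finally show ?thesis
            unfolding a2 K p(2) using that(1) by (intro norm_geometric_mean_le_half)
        qed
      qed
      have "real T * (32 * (1 / 2) ^ r) \<le> real T * (32 * (\<delta> / (64 * real T)))"
        using half_power by (intro mult_left_mono) auto
      also have "\<dots> = \<delta> / 2" using T1 by simp
      finally have err: "real T * (32 * (1 / 2) ^ r) \<le> \<delta> / 2" .
      have "cos \<theta> > 0" using \<theta>0 \<theta>6 pi_gt_zero by (intro cos_gt_zero) linarith+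
      moreover have "real (2 * T + 1) * \<theta> = pi / 2"
      proof -
        have "2 * real T + 1 \<noteq> 0" by linarith
        then show ?thesis by (simp add: \<theta>_def field_simps)
      qed
      ultimately have "1 - 2 * (real T * (32 * (1 / 2) ^ r)) \<le> success_prob N U A x\<^sub>1"
        using final_amplitude[OF c1_def, of T] err assms(5) A(3) U by (simp add: N)
      then show "1 - \<delta> \<le> success_prob (2 ^ n) U A x\<^sub>1"
        using err by (simp add: N)
    qed
  qed
qed

theorem theorem7:
  "\<exists>C::real. \<exists>K::nat. C > 0 \<and>
    (\<forall>n::nat. \<forall>\<psi>\<^sub>1 \<Delta> \<delta> :: real.
       n \<ge> 1 \<longrightarrow> \<psi>\<^sub>1 > 0 \<longrightarrow> \<Delta> > 0 \<longrightarrow> 0 < \<delta> \<longrightarrow> \<delta> < 1 \<longrightarrow>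
       (\<exists>A. valid_alg (2 ^ n) A \<and>
          real (num_queries A) \<le> C / (\<psi>\<^sub>1 * \<Delta>) *
             (ln (2 + real (2 ^ n)) + ln (2 + 1 / \<psi>\<^sub>1) + ln (2 + 1 / \<Delta>) + ln (2 + 1 / \<delta>)) ^ K \<and>
          (\<forall>U :: nat \<Rightarrow> nat \<Rightarrow> complex. \<forall>\<psi> :: nat \<Rightarrow> real. \<forall>\<sigma> :: nat \<Rightarrow> nat.
             unitary_fn (2 ^ n) U \<and>
             bij_betw \<sigma> {..<2 ^ n} {..<2 ^ n} \<and>
             (\<forall>j < 2 ^ n. \<psi> j \<ge> 0 \<and> U (\<sigma> j) 0 = complex_of_real (\<psi> j)) \<and>
             (\<Sum>j < 2 ^ n. (\<psi> j)\<^sup>2) = 1 \<and>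
             \<psi> 0 > \<psi> 1 \<and>
             (\<forall>j. 1 \<le> j \<and> j + 1 < 2 ^ n \<longrightarrow> \<psi> j \<ge> \<psi> (j + 1)) \<and>
             \<psi> 0 = \<psi>\<^sub>1 \<and> \<Delta> = \<psi> 0 - \<psi> 1
             \<longrightarrow> success_prob (2 ^ n) U A (\<sigma> 0) \<ge> 1 - \<delta>)))"
\<comment> \<open>Exponent 1 suffices, as logarithms enter the query count only through the kernel
  power \<open>r\<close>.\<close>
proof (rule exI[of _ 24000], rule exI[of _ 1], intro conjI allI impI)
  show "(0::real) < 24000" by simp
  fix n :: nat and \<psi>\<^sub>1 \<Delta> \<delta> :: real
  assume n: "n \<ge> 1" and pos: "\<psi>\<^sub>1 > 0" "\<Delta> > 0" "0 < \<delta>" "\<delta> < 1"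
  let ?S = "ln (2 + real (2 ^ n)) + ln (2 + 1 / \<psi>\<^sub>1) + ln (2 + 1 / \<Delta>) + ln (2 + 1 / \<delta>)"
  let ?hyp = "\<lambda>U \<psi> \<sigma>. unitary_fn (2 ^ n) U \<and>
             bij_betw \<sigma> {..<2 ^ n} {..<2 ^ n} \<and>
             (\<forall>j < 2 ^ n. \<psi> j \<ge> 0 \<and> U (\<sigma> j) 0 = complex_of_real (\<psi> j)) \<and>
             (\<Sum>j < 2 ^ n. (\<psi> j)\<^sup>2) = 1 \<and>
             \<psi> 0 > \<psi> 1 \<and>
             (\<forall>j. 1 \<le> j \<and> j + 1 < 2 ^ n \<longrightarrow> \<psi> j \<ge> \<psi> (j + 1)) \<and>
             \<psi> 0 = \<psi>\<^sub>1 \<and> \<Delta> = \<psi> 0 - \<psi> (1::nat)"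
  have two: "(2::nat) \<le> 2 ^ n" using power_increasing[OF n, of "2::nat"] by simp
  show "\<exists>A. valid_alg (2 ^ n) A \<and> real (num_queries A) \<le> 24000 / (\<psi>\<^sub>1 * \<Delta>) * ?S ^ 1 \<and>
      (\<forall>U \<psi> \<sigma>. ?hyp U \<psi> \<sigma> \<longrightarrow> success_prob (2 ^ n) U A (\<sigma> 0) \<ge> 1 - \<delta>)"
  proof (cases "\<Delta> \<le> \<psi>\<^sub>1 \<and> \<psi>\<^sub>1 \<le> 1")
    case False
    \<comment> \<open>Normalisation forces \<open>\<psi>\<^sub>1 \<le> 1\<close>, and nonnegativity
      of the second amplitude forces \<open>\<Delta> \<le> \<psi>\<^sub>1\<close>. Other parameters
      admit no instance, and an algorithm without queries serves.\<close>
    have vacuous: "\<not> ?hyp U \<psi> \<sigma>" for U \<psi> \<sigma>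
    proof
      assume h: "?hyp U \<psi> \<sigma>"
      have "(\<psi> 0)\<^sup>2 \<le> (\<Sum>j < 2 ^ n. (\<psi> j)\<^sup>2)"
        by (rule member_le_sum) auto
      then have "(\<psi> 0)\<^sup>2 \<le> 1" using h by simp
      then have "\<psi>\<^sub>1 \<le> 1" using h by (metis abs_le_D1 abs_square_le_1)
      moreover have "0 \<le> \<psi> 1" using h two by auto
      ultimately show False using False h by auto
    qed
    have "0 \<le> 24000 / (\<psi>\<^sub>1 * \<Delta>) * ?S ^ 1"
      using pos by (intro mult_nonneg_nonneg zero_le_power add_nonneg_nonneg ln_ge_zero) auto
    then have "valid_alg (2 ^ n) \<lparr>extra_qubits = 1, steps = [], out_map = id\<rparr> \<and>
        real (num_queries \<lparr>extra_qubits = 1, steps = [], out_map = id\<rparr>) \<le> 24000 / (\<psi>\<^sub>1 * \<Delta>) * ?S ^ 1"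
      by (simp add: valid_alg_def num_queries_def)
    then show ?thesis
      using vacuous by blast
  next
    case True
    obtain A where A: "valid_alg (2 ^ n) A" "real (num_queries A) \<le> 24000 / (\<psi>\<^sub>1 * \<Delta>) * ?S"
      "\<forall>U \<psi> x\<^sub>1. unitary_fn (2 ^ n) U \<longrightarrow> x\<^sub>1 < 2 ^ n \<longrightarrow> \<psi> x\<^sub>1 = \<psi>\<^sub>1 \<longrightarrow>
         (\<forall>x<2 ^ n. U x 0 = of_real (\<psi> x) \<and> 0 \<le> \<psi> x) \<longrightarrow>
         (\<forall>x<2 ^ n. x \<noteq> x\<^sub>1 \<longrightarrow> \<psi> x \<le> \<psi>\<^sub>1 - \<Delta>) \<longrightarrow>
         success_prob (2 ^ n) U A x\<^sub>1 \<ge> 1 - \<delta>"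
      using search_algorithm_exists[OF pos(2) conjunct1[OF True] conjunct2[OF True] pos(3,4), of n] .
    have "success_prob (2 ^ n) U A (\<sigma> 0) \<ge> 1 - \<delta>" if h: "?hyp U \<psi> \<sigma>" for U \<psi> \<sigma>
    proof -
      have bij: "bij_betw \<sigma> {..<2 ^ n} {..<2 ^ n}" using h by blast
      have mono: "\<psi> j \<le> \<psi> 1" if "1 \<le> j" "j < 2 ^ n" for j
        using that
      proof (induction j rule: dec_induct)
        case (step j)
        then have "\<psi> (j + 1) \<le> \<psi> j" using h by simp
        then show ?case using step by simp
      qed simp
      \<comment> \<open>Amplitudes indexed by basis state instead of rank. Every state other than
        \<open>\<sigma> 0\<close> has rank at least 1, so monotonicity bounds its amplitude by the
        second largest.\<close>
      define \<phi> where "\<phi> x = \<psi> (inv_into {..<2 ^ n} \<sigma> x)" for x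
      have \<phi>: "\<phi> (\<sigma> j) = \<psi> j" if "j < 2 ^ n" for j
        using that bij by (simp add: \<phi>_def bij_betw_inv_into_left)
      have ex: "\<exists>j<2 ^ n. x = \<sigma> j" if "x < 2 ^ n" for x
        using that bij by (auto simp: bij_betw_def image_iff)
      show ?thesis
      proof (rule A(3)[rule_format, of U "\<sigma> 0" \<phi>])
        show "unitary_fn (2 ^ n) U" using h by blast
        show "\<sigma> 0 < 2 ^ n" using bij by (auto dest: bij_betwE)
        show "\<phi> (\<sigma> 0) = \<psi>\<^sub>1" using h by (simp add: \<phi>)
        show "U x 0 = of_real (\<phi> x) \<and> 0 \<le> \<phi> x" if "x < 2 ^ n" for x
          using ex[OF that] h \<phi> by auto
        show "\<phi> x \<le> \<psi>\<^sub>1 - \<Delta>" if x: "x < 2 ^ n" "x \<noteq> \<sigma> 0" for x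
        proof -
          obtain j where j: "j < 2 ^ n" "x = \<sigma> j" using ex[OF x(1)] by blast
          then have "1 \<le> j" using x(2) by (cases j) auto
          then show ?thesis using mono[OF _ j(1)] h j by (simp add: \<phi>)
        qed
      qed
    qed
    moreover have "real (num_queries A) \<le> 24000 / (\<psi>\<^sub>1 * \<Delta>) * ?S ^ 1"
      using A(2) by (simp only: power_one_right)
    ultimately show ?thesis using A(1) by blast
  qed
qed

end
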